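(* Let $d\ge 2$, $h\ge 1$ and $k>2d$ be integers, and let $S$ be the $k$-subdivision of the complete $d$-ary tree of height $h$. Then \[\sqrt{\frac{h}{\log_{\min\{d,(h(k+1))^2\}}(h(k+1))}}\;\le\;\phi(S)\;\le\;\frac{10h}{\log_{d+1}(k/2d)}+14.\]
   Context: An anagram is a word of the form $WP$ where $W$ is a non-empty word and $P$ is a permutation of $W$. A vertex colouring of a graph is anagram-free if the sequence of colours along every path of the graph is not an anagram. $\phi(G)$ is the minimum number of colours in an anagram-free colouring of $G$. The $k$-subdivision of a graph $G$ is obtained by replacing every edge of $G$ by a path with exactly $k$ internal (division) vertices. The complete $d$-ary tree of height $h$ is the rooted tree in which every non-leaf vertex has exactly $d$ children and every leaf is at distance $h$ from the root. *)

theory Defs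
  imports Complex_Main "HOL-Library.Multiset"
begin

text \<open>An undirected simple graph is a pair of its vertex set and its edge set, each edge being the
  two-element set of its endpoints.\<close>

type_synonym 'a graph = "'a set \<times> 'a set set"

abbreviation verts :: "'a graph \<Rightarrow> 'a set" where "verts \<equiv> fst"

abbreviation edges :: "'a graph \<Rightarrow> 'a set set" where "edges \<equiv> snd"

definition is_path :: "'a graph \<Rightarrow> 'a list \<Rightarrow> bool" where
  "is_path G p \<longleftrightarrow> p \<noteq> [] \<and> distinct p \<and> set p \<subseteq> verts G \<and>
     (\<forall>i. Suc i < length p \<longrightarrow> {p ! i, p ! Suc i} \<in> edges G)"

definition anagram :: "'c list \<Rightarrow> bool" where
  "anagram w \<longleftrightarrow> (\<exists>W P. W \<noteq> [] \<and> mset P = mset W \<and> w = W @ P)"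

definition anagram_free_colouring :: "'a graph \<Rightarrow> ('a \<Rightarrow> 'c) \<Rightarrow> bool" where
  "anagram_free_colouring G c \<longleftrightarrow> (\<forall>p. is_path G p \<longrightarrow> \<not> anagram (map c p))"

text \<open>The minimum exists for every finite graph, because a colouring that is injective on the
  vertices is anagram-free; for infinite graphs the value may be meaningless.\<close>

definition anagram_free_number :: "'a graph \<Rightarrow> nat" where
  "anagram_free_number G =
     (LEAST n. \<exists>c :: 'a \<Rightarrow> nat. c ` verts G \<subseteq> {..<n} \<and> anagram_free_colouring G c)"

text \<open>The path of length \<open>k + 1\<close> replacing an edge \<open>{u, v}\<close> has no preferred direction.
  A division vertex at distance \<open>i\<close> from \<open>u\<close> along that path is at distance \<open>k + 1 - i\<close> from \<open>v\<close>,
  and it is represented by the set \<open>{(u, i), (v, k + 1 - i)}\<close>. This is symmetric in the endpoints: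
  \<open>subdiv_vertex k u v i = subdiv_vertex k v u (k + 1 - i)\<close> for \<open>i \<le> k + 1\<close>.\<close>

datatype 'a subdiv = Orig 'a | Division "('a \<times> nat) set"

definition subdiv_vertex :: "nat \<Rightarrow> 'a \<Rightarrow> 'a \<Rightarrow> nat \<Rightarrow> 'a subdiv" where
  "subdiv_vertex k u v i =
     (if i = 0 then Orig u else if i = k + 1 then Orig v
      else Division {(u, i), (v, k + 1 - i)})"

definition subdivision :: "nat \<Rightarrow> 'a graph \<Rightarrow> 'a subdiv graph" where
  "subdivision k G =
     (Orig ` verts G \<union>
        {subdiv_vertex k u v i |u v i. {u, v} \<in> edges G \<and> 1 \<le> i \<and> i \<le> k},
      {{subdiv_vertex k u v i, subdiv_vertex k u v (i + 1)} |u v i. {u, v} \<in> edges G \<and> i \<le> k})"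

text \<open>A vertex is the list of child indices on the way up to the root \<open>[]\<close>; the parent of
  \<open>i # xs\<close> is \<open>xs\<close> and the depth of a vertex is its length.\<close>

definition complete_tree :: "nat \<Rightarrow> nat \<Rightarrow> nat list graph" where
  "complete_tree d h =
     ({xs. set xs \<subseteq> {..<d} \<and> length xs \<le> h},
      {{xs, i # xs} |xs i. set xs \<subseteq> {..<d} \<and> length xs < h \<and> i < d})"

end

(*
  Lower bound.  In any colouring of a complete d-ary tree of height h with c colours, some colour
  class contains a (topologically embedded) complete d-ary tree with at least (h + 1)/c levels.  If
  two leaves of it had root paths with the same colour counts, then the path joining them, without
  one of its ends, would be an anagram, because the branching vertex has the same colour as the
  leaves.  Counting the possible colour counts gives d^h <= n^(c^2) for n = h(k + 1).

  Upper bound.  Eight letters suffice for arbitrarily long words without anagrams; the odd division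
  vertices of each edge carry such a word, so a path inside one edge is no anagram.  The levels of
  the tree are cut into blocks of g levels, each with three private colours: one for the original
  vertices, and two for the even division vertices that are marked.  An edge to child s, with j
  levels of edges of its block below it, has (s + 1)(d + 1)^j marks of either kind, so that an edge
  outweighs all lower edges of its block on a vertical path, and siblings have different weights.
  The marks of the first kind sit near the upper end of the edge and those of the second kind
  further down.  A balanced path is cut in the middle of an edge of its top block, and the cut
  leaves the marks of at least one kind unbalanced.
*)

theory Submission
  imports Defs "HOL-Library.FuncSet"
begin

section \<open>Words without anagrams\<close>

definition avoids_anagrams :: "'a list \<Rightarrow> bool" where
  "avoids_anagrams w \<longleftrightarrow> (\<forall>x v y. w = x @ v @ y \<longrightarrow> \<not> anagram v)"

lemma concat_map_prefixE:
  assumes "concat (map \<sigma> w) = x @ y"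
  obtains u v where "w = u @ v" "x = concat (map \<sigma> u)"
  | u a v p s where "w = u @ a # v" "x = concat (map \<sigma> u) @ p" "\<sigma> a = p @ s" "p \<noteq> []" "s \<noteq> []"
  using assms
proof (induction w arbitrary: x thesis)
  case Nil
  then show ?case by auto
next
  case (Cons b w)
  have "\<sigma> b @ concat (map \<sigma> w) = x @ y" using Cons.prems(3) by simp
  then consider (1) z where "x = \<sigma> b @ z" "concat (map \<sigma> w) = z @ y"
    | (2) s where "\<sigma> b = x @ s" "s \<noteq> []"
    by (metis append_eq_append_conv2 append_Nil2)
  then show ?case
  proof cases
    case 1
    show ?thesis
    proof (rule Cons.IH[OF _ _ 1(2)])
      fix u v assume "w = u @ v" "z = concat (map \<sigma> u)"
      then show thesis using Cons.prems(1)[of "b # u" v] 1(1) by simp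
    next
      fix u a v p s
      assume "w = u @ a # v" "z = concat (map \<sigma> u) @ p" "\<sigma> a = p @ s" "p \<noteq> []" "s \<noteq> []"
      then show thesis using Cons.prems(2)[of "b # u" a v p s] 1(1) by simp
    qed
  next
    case 2
    show ?thesis
    proof (cases "x = []")
      case True
      then show ?thesis using Cons.prems(1)[of "[]" "b # w"] by simp
    next
      case False
      then show ?thesis using Cons.prems(2)[of "[]" b w x s] 2 by simp
    qed
  qed
qed

section \<open>Morphisms that preserve the absence of anagrams\<close>

text \<open>A criterion in the style of Dekking: the letters are weighted by integers modulo \<open>N\<close> so that
  every image has weight zero, and the weights of proper prefixes of images contain no nontrivial
  three-term arithmetic progression. The two factors of an anagram in an img word then start and
  end at prefixes of the same weight, hence at the same phase of the blocks, and can be shifted to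
  block boundaries. For this, \<open>blk v\<close> is the only prefix of weight \<open>v\<close> of any image, or the only
  suffix left after one, as \<open>by_prefix v\<close> tells.\<close>

locale progression_free_morphism =
  fixes A :: "'a set" and \<sigma> :: "'a \<Rightarrow> 'a list" and f :: "'a \<Rightarrow> int" and N :: int
    and V :: "int set" and by_prefix :: "int \<Rightarrow> bool"
    and blk :: "int \<Rightarrow> 'a list"
  assumes image_in: "a \<in> A \<Longrightarrow> set (\<sigma> a) \<subseteq> A"
    and length_image: "a \<in> A \<Longrightarrow> length (\<sigma> a) \<ge> 2"
    and image_weight: "a \<in> A \<Longrightarrow> sum_list (map f (\<sigma> a)) mod N = 0"
    and prefix_weight: "a \<in> A \<Longrightarrow> \<sigma> a = p @ s \<Longrightarrow> p \<noteq> [] \<Longrightarrow> s \<noteq> [] \<Longrightarrow>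
      sum_list (map f p) mod N \<in> V - {0}"
    and zero_in: "0 \<in> V"
    and progression_free: "x \<in> V \<Longrightarrow> y \<in> V \<Longrightarrow> z \<in> V \<Longrightarrow> (x + z - 2 * y) mod N = 0 \<Longrightarrow> x = y \<and> y = z"
    and phase_word: "a \<in> A \<Longrightarrow> \<sigma> a = p @ s \<Longrightarrow> p \<noteq> [] \<Longrightarrow> s \<noteq> [] \<Longrightarrow>
      (if by_prefix (sum_list (map f p) mod N) then p else s) = blk (sum_list (map f p) mod N)"
    and image_mset_inj: "set u \<subseteq> A \<Longrightarrow> set v \<subseteq> A \<Longrightarrow>
      mset (concat (map \<sigma> u)) = mset (concat (map \<sigma> v)) \<Longrightarrow> mset u = mset v"
begin

abbreviation weight :: "'a list \<Rightarrow> int" where "weight w \<equiv> sum_list (map f w)"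

abbreviation img :: "'a list \<Rightarrow> 'a list" where "img w \<equiv> concat (map \<sigma> w)"

lemma weight_image: "set w \<subseteq> A \<Longrightarrow> weight (img w) mod N = 0"
proof (induction w)
  case (Cons a w)
  then have "weight (\<sigma> a) mod N = 0" "weight (img w) mod N = 0" using image_weight by auto
  then show ?case by (simp add: mod_add_eq[symmetric])
qed simp

text \<open>Whole images have weight zero modulo \<open>N\<close> and proper prefixes of images do
  not, so the weight of a prefix tells whether it ends at a boundary of letter images.\<close>

lemma phase:
  assumes "set w \<subseteq> A" "img w = x @ y"
  obtains (boundary) u v where "weight x mod N = 0" "w = u @ v" "x = img u"
  | (inner) u a v p s where "weight x mod N = weight p mod N" "weight x mod N \<in> V - {0}" "a \<in> A"
      "w = u @ a # v" "x = img u @ p" "\<sigma> a = p @ s" "p \<noteq> []" "s \<noteq> []"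
proof (rule concat_map_prefixE[OF assms(2)])
  fix u v assume "w = u @ v" "x = img u"
  then show thesis using boundary weight_image[of u] assms(1) by auto
next
  fix u a v p s
  assume *: "w = u @ a # v" "x = img u @ p" "\<sigma> a = p @ s" "p \<noteq> []" "s \<noteq> []"
  have "weight (img u) mod N = 0" "a \<in> A" using weight_image[of u] assms(1) * by auto
  then have "weight x mod N = weight p mod N" using *(2) by (simp add: mod_add_eq[symmetric])
  then show thesis using inner[of p a u v s] * \<open>a \<in> A\<close> prefix_weight[of a p s] by auto
qed

lemma phase_in: "set w \<subseteq> A \<Longrightarrow> img w = x @ y \<Longrightarrow> weight x mod N \<in> V"
  by (elim phase) (use zero_in in auto)

text \<open>Only multisets enter, since moving the cuts of an anagram to boundaries may change its
  factors, but not their letter counts. The boundaries cut two adjacent factors out of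
  \<open>w\<close>, and \<open>image_mset_inj\<close> makes one a permutation of the other.\<close>

lemma no_aligned_anagram:
  assumes "set w \<subseteq> A" "avoids_anagrams w"
    and "w = u1 @ v1" "w = u2 @ v2" "w = u3 @ v3"
    and "mset (img u1) + mset W = mset (img u2)"
    and "mset (img u2) + mset P = mset (img u3)"
    and "mset W = mset P"
  shows "W = []"
proof (rule ccontr)
  assume W: "W \<noteq> []"
  have step: "\<exists>t. u' = u @ t"
    if "w = u @ v" "w = u' @ v'" "mset (img u) + mset X = mset (img u')" for u v u' v' X
  proof (cases "length u \<le> length u'")
    case True
    then have "u' = u @ drop (length u) u'"
      using that(1,2) by (metis append_eq_append_conv_if append_take_drop_id)
    then show ?thesis by blast
  next
    case False
    then have "u = u' @ drop (length u') u"
      using that(1,2) by (metis append_eq_append_conv_if append_take_drop_id nle_le)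
    \<comment> \<open>The surplus \<open>t\<close> has an empty image and is therefore
      empty.\<close>
    then obtain t where "u = u' @ t" by blast
    then have "mset (img u') + mset (img t @ X) = mset (img u') + {#}" using that(3) by simp
    then have "img t = []" by (metis add_left_cancel mset_zero_iff append_is_Nil_conv)
    moreover have "set t \<subseteq> A" using that assms(1) \<open>u = u' @ t\<close> by auto
    ultimately have "t = []"
      by (cases t) (use length_image in force)+
    then show ?thesis using \<open>u = u' @ t\<close> by simp
  qed
  obtain t where t: "u2 = u1 @ t" using step[OF assms(3,4,6)] by blast
  obtain r where r: "u3 = u2 @ r" using step[OF assms(4,5,7)] by blast
  have "mset (img t) = mset W" "mset (img r) = mset P" using assms(6,7) t r by auto
  then have "mset t = mset r"
    using image_mset_inj[of t r] assms(1,5,8) t r by simp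
  moreover have "t \<noteq> []" using \<open>mset (img t) = mset W\<close> W by auto
  ultimately have "anagram (t @ r)" unfolding anagram_def by metis
  moreover have "w = u1 @ (t @ r) @ v3" using assms(5) t r by simp
  ultimately show False using assms(2) unfolding avoids_anagrams_def by blast
qed

theorem avoids_anagrams_image:
  assumes w: "set w \<subseteq> A" and "avoids_anagrams w"
  shows "avoids_anagrams (img w)"
  unfolding avoids_anagrams_def anagram_def
proof (intro allI impI notI, elim exE conjE)
  fix x v y W P
  assume eq: "img w = x @ v @ y" and v: "W \<noteq> []" "mset P = mset W" "v = W @ P"
  have e: "img w = x @ (W @ P @ y)" "img w = (x @ W) @ (P @ y)" "img w = (x @ W @ P) @ y"
    using eq v by auto
  have WP: "weight W = weight P"
    by (metis v(2) mset_map sum_mset_sum_list)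
  \<comment> \<open>Both halves have the same weight, so the weights at the three cuts form an
    arithmetic progression modulo \<open>N\<close>.\<close>
  have "(weight x mod N + weight (x @ W @ P) mod N - 2 * (weight (x @ W) mod N)) mod N
      = (weight x + weight (x @ W @ P) - 2 * weight (x @ W)) mod N"
    by (intro mod_diff_cong mod_add_cong mod_mult_cong) simp_all
  also have "\<dots> = 0" using WP by simp
  finally have "weight x mod N = weight (x @ W) mod N \<and>
      weight (x @ W) mod N = weight (x @ W @ P) mod N"
    by (rule progression_free[OF e[THEN phase_in[OF w]]])
  then have phases: "weight (x @ W) mod N = weight x mod N" "weight (x @ W @ P) mod N = weight x mod N"
    by simp_all
  show False
  proof (cases "weight x mod N = 0")
    case True
    have *: "\<exists>u v. w = u @ v \<and> X = img u" if "img w = X @ Y" "weight X mod N = 0" for X Y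
      by (rule phase[OF w that(1)]) (use that(2) in auto)
    obtain u1 v1 where 1: "w = u1 @ v1" "x = img u1" using *[OF e(1)] True by blast
    obtain u2 v2 where 2: "w = u2 @ v2" "x @ W = img u2" using *[OF e(2)] True phases by auto
    obtain u3 v3 where 3: "w = u3 @ v3" "x @ W @ P = img u3" using *[OF e(3)] True phases by auto
    have "mset (img u1) + mset W = mset (img u2)" "mset (img u2) + mset P = mset (img u3)"
      using 1(2) 2(2) 3(2) by (metis mset_append append.assoc)+
    then show False
      using no_aligned_anagram[OF w assms(2) 1(1) 2(1) 3(1)] v(1) v(2)[symmetric] by blast
  next
    case False
    have *: "\<exists>u a v p s. w = u @ a # v \<and> X = img u @ p \<and> \<sigma> a = p @ s \<and> a \<in> A \<and> p \<noteq> [] \<and> s \<noteq> []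
        \<and> weight p mod N = weight x mod N"
      if "img w = X @ Y" "weight X mod N = weight x mod N" for X Y
    proof (rule phase[OF w that(1)])
      assume "weight X mod N = 0"
      then show ?thesis using that(2) False by simp
    qed (use that(2) in auto)
    obtain u1 a1 v1 p1 s1 where 1: "w = u1 @ a1 # v1" "x = img u1 @ p1" "\<sigma> a1 = p1 @ s1"
        "a1 \<in> A" "p1 \<noteq> []" "s1 \<noteq> []" "weight p1 mod N = weight x mod N"
      using *[OF e(1)] by blast
    obtain u2 a2 v2 p2 s2 where 2: "w = u2 @ a2 # v2" "x @ W = img u2 @ p2" "\<sigma> a2 = p2 @ s2"
        "a2 \<in> A" "p2 \<noteq> []" "s2 \<noteq> []" "weight p2 mod N = weight x mod N"
      using *[OF e(2) phases(1)] by blast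
    obtain u3 a3 v3 p3 s3 where 3: "w = u3 @ a3 # v3" "x @ W @ P = img u3 @ p3" "\<sigma> a3 = p3 @ s3"
        "a3 \<in> A" "p3 \<noteq> []" "s3 \<noteq> []" "weight p3 mod N = weight x mod N"
      using *[OF e(3) phases(2)] by blast
    have m: "mset x = mset (img u1) + mset p1" "mset x + mset W = mset (img u2) + mset p2"
        "mset x + mset W + mset P = mset (img u3) + mset p3"
      by (metis 1(2) mset_append, metis 2(2) mset_append, metis 3(2) mset_append append.assoc)
    \<comment> \<open>The common residue fixes the part of the letter image before each cut, or the
      part after it, as \<open>by_prefix\<close> tells.\<close>
    have sp: "if by_prefix (weight x mod N) then mset p1 = mset p2 else mset s1 = mset s2"
        "if by_prefix (weight x mod N) then mset p1 = mset p3 else mset s1 = mset s3"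
      using phase_word[OF 1(4,3,5,6)] phase_word[OF 2(4,3,5,6)] phase_word[OF 3(4,3,5,6)]
        1(7) 2(7) 3(7) by (simp_all split: if_splits)
    show False
    proof (cases "by_prefix (weight x mod N)")
      case True
      then have p: "mset p2 = mset p1" "mset p3 = mset p1" using sp by simp_all
      \<comment> \<open>Cancelling the common prefix moves all cuts back to the boundaries before
        \<open>a1\<close>, \<open>a2\<close>, \<open>a3\<close>.\<close>
      have "mset (img u1) + mset p1 + mset W = mset (img u2) + mset p1"
          "mset (img u2) + mset p1 + mset P = mset (img u3) + mset p1"
        unfolding m[unfolded p, symmetric] by (rule refl)+
      then show False
        using no_aligned_anagram[OF w assms(2) 1(1) 2(1) 3(1)] v(1,2)
          add_right_imp_eq[of "mset (img u1) + mset W" "mset p1" "mset (img u2)"]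
          add_right_imp_eq[of "mset (img u2) + mset P" "mset p1" "mset (img u3)"]
        by (simp add: ac_simps)
    next
      case False
      then have s: "mset s2 = mset s1" "mset s3 = mset s1" using sp by simp_all
      have i: "mset (img (u @ [a])) = mset (img u) + mset p + mset s" if "\<sigma> a = p @ s" for u a p s
        using that by simp
      \<comment> \<open>Here the cuts move forward over the common suffix, to the boundaries after
        \<open>a1\<close>, \<open>a2\<close>, \<open>a3\<close>.\<close>
      have "mset (img (u1 @ [a1])) + mset W = mset (img (u2 @ [a2]))"
          "mset (img (u2 @ [a2])) + mset P = mset (img (u3 @ [a3]))"
        unfolding i[OF 1(3)] i[OF 2(3)] i[OF 3(3)] s m[symmetric] by (simp_all only: add_ac)
      moreover have "w = (u1 @ [a1]) @ v1" "w = (u2 @ [a2]) @ v2" "w = (u3 @ [a3]) @ v3"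
        using 1(1) 2(1) 3(1) by simp_all
      ultimately show False
        using no_aligned_anagram[OF w assms(2)] v(1) v(2)[symmetric] by blast
    qed
  qed
qed

lemma length_image_ge: "set w \<subseteq> A \<Longrightarrow> length (img w) \<ge> 2 * length w"
  by (induction w) (use length_image in force)+

text \<open>Iteration on a single letter at least doubles the length each time; a prefix of the
  result has the length wanted.\<close>

lemma avoids_anagrams_exists:
  assumes "A \<noteq> {}"
  shows "\<exists>w. length w = n \<and> set w \<subseteq> A \<and> avoids_anagrams w"
proof -
  have long: "\<exists>w. length w \<ge> n + 1 \<and> set w \<subseteq> A \<and> avoids_anagrams w" for n
  proof (induction n)
    case 0
    obtain a where "a \<in> A" using assms by blast
    have "\<not> anagram v" if "[a] = x @ v @ y" for x v y
    proof
      assume "anagram v"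
      then obtain W P where *: "W \<noteq> []" "mset P = mset W" "v = W @ P" unfolding anagram_def by blast
      then have "length P = length W" by (metis size_mset)
      moreover have "length W + length P \<le> 1" using arg_cong[OF that, of length] *(3) by simp
      ultimately show False using *(1) by (cases W) auto
    qed
    then have "avoids_anagrams [a]" unfolding avoids_anagrams_def by blast
    then show ?case using \<open>a \<in> A\<close> by (intro exI[of _ "[a]"]) simp
  next
    case (Suc n)
    then obtain w where w: "length w \<ge> n + 1" "set w \<subseteq> A" "avoids_anagrams w" by blast
    have "set (img w) \<subseteq> A" using w(2) image_in by fastforce
    then show ?case
      using avoids_anagrams_image[OF w(2,3)] length_image_ge[OF w(2)] w(1)
      by (intro exI[of _ "img w"]) auto
  qed
  obtain w where w: "length w \<ge> n + 1" "set w \<subseteq> A" "avoids_anagrams w" using long by blast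
  have "avoids_anagrams (take n w)"
    unfolding avoids_anagrams_def
  proof (intro allI impI)
    fix x v y assume "take n w = x @ v @ y"
    then have "w = x @ v @ (y @ drop n w)" by (metis append.assoc append_take_drop_id)
    then show "\<not> anagram v" using w(3) unfolding avoids_anagrams_def by blast
  qed
  then show ?thesis using w set_take_subset[of n w] by (intro exI[of _ "take n w"]) auto
qed

end

section \<open>A morphism on eight letters\<close>

text \<open>Found by a computer search over progression-free sets of residues.\<close>

definition eight_morphism :: "nat \<Rightarrow> nat list" where
  "eight_morphism a = [[5, 4], [2, 3, 4], [2, 7, 5, 1, 7], [0, 3, 6, 7], [0, 1, 5, 1, 7], [0, 2, 6], [0, 2, 5, 0, 7], [0, 2, 5, 3, 5, 1, 7]] ! a"

definition eight_weight :: "nat \<Rightarrow> int" where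
  "eight_weight a = [3, 7, 11, 12, 16, 23, 25, 38] ! a"

text \<open>At the residues 3, 11, 14, 15 and 37 this is the prefix before the cut, at 1, 10, 23 and
  33 the suffix after it.\<close>

definition eight_block :: "int \<Rightarrow> nat list" where
  "eight_block v = (if v = 1 then [7] else if v = 3 then [0] else if v = 10 then [5, 1, 7] else if v = 11 then [2] else if v = 14 then [0, 2] else if v = 15 then [0, 3] else if v = 23 then [4] else if v = 33 then [1, 7] else if v = 37 then [0, 2, 5] else [])"

lemma eight_morphism_simps [simp]:
  "eight_morphism 0 = [5, 4]" "eight_morphism 1 = [2, 3, 4]" "eight_morphism 2 = [2, 7, 5, 1, 7]" "eight_morphism 3 = [0, 3, 6, 7]" "eight_morphism 4 = [0, 1, 5, 1, 7]" "eight_morphism 5 = [0, 2, 6]" "eight_morphism 6 = [0, 2, 5, 0, 7]" "eight_morphism 7 = [0, 2, 5, 3, 5, 1, 7]"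
  by (simp_all add: eight_morphism_def)

lemma eight_morphism_Suc [simp]: "eight_morphism (Suc 0) = [2, 3, 4]"
  by (simp add: eight_morphism_def)

lemma eight_weight_Suc [simp]: "eight_weight (Suc 0) = 7"
  by (simp add: eight_weight_def)

lemma eight_weight_simps [simp]:
  "eight_weight 0 = 3" "eight_weight 1 = 7" "eight_weight 2 = 11" "eight_weight 3 = 12" "eight_weight 4 = 16" "eight_weight 5 = 23" "eight_weight 6 = 25" "eight_weight 7 = 38"
  by (simp_all add: eight_weight_def)

lemma less_eight: "a \<in> {..<8} \<longleftrightarrow> a \<in> {0, 1, 2, 3, 4, 5, 6, 7 :: nat}"
  by auto

lemma eight_cuts:
  assumes "a \<in> {..<8}" "eight_morphism a = p @ s" "p \<noteq> []" "s \<noteq> []"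
  shows "sum_list (map eight_weight p) mod 39 \<in> {1, 3, 10, 11, 14, 15, 23, 33, 37}"
    and "(if sum_list (map eight_weight p) mod 39 \<in> {3, 11, 14, 15, 37} then p else s)
      = eight_block (sum_list (map eight_weight p) mod 39)"
  using assms unfolding less_eight
  by (elim insertE emptyE; auto simp: Cons_eq_append_conv eight_block_def)+

lemma sum_eight: "(\<Sum>a<(8::nat). F a) = F 0 + F 1 + F 2 + F 3 + F 4 + F 5 + F 6 + F 7"
  by (simp add: eval_nat_numeral add_ac)

lemma count_image_eight:
  assumes "set u \<subseteq> {..<8}"
  shows "count (mset (concat (map eight_morphism u))) b
    = (\<Sum>a<8. count (mset u) a * count (mset (eight_morphism a)) b)"
  using assms
proof (induction u)
  case (Cons x u)
  have "(\<Sum>a<8. (if x = a then 1 else 0) * count (mset (eight_morphism a)) b)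
      = count (mset (eight_morphism x)) b"
    using Cons.prems by (simp add: if_distrib[of "\<lambda>t. t * _"] sum.delta cong: if_cong)
  moreover have "count (mset (x # u)) a = count (mset u) a + (if x = a then 1 else 0)" for a by simp
  ultimately show ?case
    using Cons by (simp add: algebra_simps sum.distrib)
qed simp

text \<open>The letter counts of an image arise from those of the word by a nonsingular matrix;
  \<open>linarith\<close> solves the system with one equation for each letter.\<close>

lemma eight_parikh_inj:
  assumes "set u \<subseteq> {..<8}" "set v \<subseteq> {..<8}"
    and eq: "mset (concat (map eight_morphism u)) = mset (concat (map eight_morphism v))"
  shows "mset u = mset v"
proof (rule multiset_eqI)
  fix a
  define x y where "x = count (mset u)" and "y = count (mset v)"
  have "(\<Sum>a<8. x a * count (mset (eight_morphism a)) b)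
      = (\<Sum>a<8. y a * count (mset (eight_morphism a)) b)" for b
    using count_image_eight[OF assms(1)] count_image_eight[OF assms(2)] eq unfolding x_def y_def by metis
  note eqs = this[of 0] this[of 1] this[of 2] this[of 3] this[of 4] this[of 5] this[of 6] this[of 7]
  have "x 0 = y 0" "x (Suc 0) = y (Suc 0)" "x 2 = y 2" "x 3 = y 3" "x 4 = y 4" "x 5 = y 5"
      "x 6 = y 6" "x 7 = y 7"
    using eqs[unfolded sum_eight, simplified] by linarith+
  then have "\<forall>a \<in> {0, 1, 2, 3, 4, 5, 6, 7}. x a = y a" by simp
  moreover have "x a = 0 \<and> y a = 0" if "a \<notin> {..<8}"
    using that assms(1,2) by (auto simp: x_def y_def count_eq_zero_iff subset_iff)
  ultimately have "x a = y a" unfolding less_eight by (cases "a \<in> {..<8}") (auto simp only: less_eight)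
  then show "count (mset u) a = count (mset v) a" unfolding x_def y_def .
qed

interpretation eight: progression_free_morphism "{..<8}" eight_morphism eight_weight 39
  "{0, 1, 3, 10, 11, 14, 15, 23, 33, 37}" "\<lambda>v. v \<in> {3, 11, 14, 15, 37}" eight_block
proof
  fix a :: nat assume "a \<in> {..<8}"
  then show "set (eight_morphism a) \<subseteq> {..<8}" "2 \<le> length (eight_morphism a)"
    "sum_list (map eight_weight (eight_morphism a)) mod 39 = 0"
    unfolding less_eight by auto
next
  fix x y z :: int
  assume x: "x \<in> {0, 1, 3, 10, 11, 14, 15, 23, 33, 37}" and y: "y \<in> {0, 1, 3, 10, 11, 14, 15, 23, 33, 37}"
    and z: "z \<in> {0, 1, 3, 10, 11, 14, 15, 23, 33, 37}" and *: "(x + z - 2 * y) mod 39 = 0"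
  have "0 \<le> z" "z < 39" using z by auto
  have "z - (2 * y - x) = x + z - 2 * y" by simp
  then have "z mod 39 = (2 * y - x) mod 39" using * by (simp only: mod_eq_dvd_iff dvd_eq_mod_eq_0)
  then have z_eq: "z = (2 * y - x) mod 39" using \<open>0 \<le> z\<close> \<open>z < 39\<close> by simp
  \<comment> \<open>The third term is determined by the other two, so checking a hundred pairs
    suffices.\<close>
  have "\<forall>x \<in> {0, 1, 3, 10, 11, 14, 15, 23, 33, 37}. \<forall>y \<in> {0, 1, 3, 10, 11, 14, 15, 23, 33, 37}.
      (2 * y - x) mod 39 \<in> {0, 1, 3, 10, 11, 14, 15, 23, 33, 37} \<longrightarrow> x = (y :: int)"
    by simp
  from bspec[OF bspec[OF this x] y] z have "x = y" unfolding z_eq by (rule mp)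
  then show "x = y \<and> y = z" using z_eq \<open>0 \<le> z\<close> \<open>z < 39\<close> y by auto
next
  fix a :: nat and p s assume "a \<in> {..<8}" "eight_morphism a = p @ s" "p \<noteq> []" "s \<noteq> []"
  note cuts = eight_cuts[OF this]
  show "sum_list (map eight_weight p) mod 39 \<in> {0, 1, 3, 10, 11, 14, 15, 23, 33, 37} - {0}"
    using cuts(1) by auto
  show "(if sum_list (map eight_weight p) mod 39 \<in> {3, 11, 14, 15, 37} then p else s)
      = eight_block (sum_list (map eight_weight p) mod 39)"
    by (rule cuts(2))
next
  show "0 \<in> {0, 1, 3, 10, 11, 14, 15, 23, 33, 37 :: int}" by simp
qed (rule eight_parikh_inj)

theorem avoids_anagrams_eight_letters:
  "\<exists>w :: nat list. length w = n \<and> set w \<subseteq> {..<8} \<and> avoids_anagrams w"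
proof -
  have "(0 :: nat) \<in> {..<8}" by simp
  then show ?thesis by (intro eight.avoids_anagrams_exists) blast
qed

section \<open>Marked edges on vertical chains\<close>

text \<open>Telescopes, as \<open>d * (d + 1) ^ m = (d + 1) ^ (m + 1) - (d + 1) ^ m\<close>. It
  bounds the marks of one kind that the levels from \<open>a\<close> to \<open>b - 1\<close> can
  have together.\<close>

lemma geometric_sum_interval:
  assumes "a \<le> (b::nat)"
  shows "Suc (\<Sum>D = a..<b. d * (d + 1) ^ (b - 1 - D)) = (d + 1) ^ (b - a)"
  using assms
proof (induction a rule: inc_induct)
  case (step n)
  then have "(\<Sum>D = n..<b. d * (d + 1) ^ (b - 1 - D))
      = d * (d + 1) ^ (b - 1 - n) + (\<Sum>D = Suc n..<b. d * (d + 1) ^ (b - 1 - D))"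
    by (simp add: sum.atLeast_Suc_lessThan)
  moreover have "b - n = Suc (b - Suc n)" using step by simp
  ultimately show ?case using step by simp
qed simp

lemma count_image_mset_set:
  "finite A \<Longrightarrow> count (image_mset f (mset_set A)) x = card (A \<inter> {e. f e = x})"
  by (simp add: count_image_mset Int_def vimage_def conj_commute)

text \<open>\<open>K\<close> is the length of a subdivided edge, \<open>g\<close> the number of
  levels in a block and \<open>u\<close> the filler word. For \<open>g \<ge> 2\<close>,
  \<open>room\<close> says \<open>5 * zone < K\<close> with \<open>zone\<close> as below: the marks
  reach down to at most \<open>3 * zone\<close>, and a cut near the top of an edge costs up to two
  zones more.\<close>

locale tree_colouring =
  fixes K d g :: nat and u :: "nat \<Rightarrow> nat"
  assumes g: "g \<ge> 1" and K: "K \<ge> 2"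
    and letters: "u i < 8"
    and fillers: "i < j \<Longrightarrow> j \<le> l \<Longrightarrow> l \<le> K \<Longrightarrow> mset (map u [i..<j]) \<noteq> mset (map u [j..<l])"
    and room: "g \<ge> 2 \<Longrightarrow> 10 * d * (d + 1) ^ (g - 1) < K"
begin

lemma mult_add_div_less: "r < K \<Longrightarrow> (D * K + r) div K = D" by simp

lemma mult_add_mod_less: "r < K \<Longrightarrow> (D * K + r) mod K = r" by simp

text \<open>Twice the largest number of marks of one kind on an edge, because marks sit at even
  positions.\<close>

definition zone :: nat where "zone = 2 * d * (d + 1) ^ (g - 1)"

definition marks :: "nat \<Rightarrow> nat \<Rightarrow> nat" where
  "marks D s = (s + 1) * (d + 1) ^ (g - 1 - D mod g)"

text \<open>The colour of the vertex at depth \<open>e\<close> on an edge to child \<open>s\<close>: the colours below \<open>8\<close> are the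
  filler letters, \<open>8\<close> is neutral, and \<open>9 + 3 * J\<close>, \<open>10 + 3 * J\<close>, \<open>11 + 3 * J\<close> are private to
  block \<open>J\<close>. The colour of an original vertex does not depend on \<open>s\<close>.\<close>

definition shade :: "nat \<Rightarrow> nat \<Rightarrow> nat" where
  "shade e s = (let D = e div K; q = e mod K in
     if q = 0 then 9 + 3 * (D div g)
     else if odd q then u (q div 2)
     else if q \<le> 2 * marks D s then 10 + 3 * (D div g)
     else if 2 * zone < q \<and> q \<le> 2 * zone + 2 * marks D s then 11 + 3 * (D div g)
     else 8)"

text \<open>A vertical chain enters only through the child index of each of its edges, so the
  counting below deals with depths alone.\<close>

abbreviation hue :: "(nat \<Rightarrow> nat) \<Rightarrow> nat \<Rightarrow> nat" where
  "hue \<sigma> e \<equiv> shade e (\<sigma> (e div K))"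

definition marked :: "nat \<Rightarrow> nat \<Rightarrow> (nat \<Rightarrow> nat) \<Rightarrow> nat set" where
  "marked i J \<sigma> = {e. hue \<sigma> e = 10 + i + 3 * J}"

lemma marks_le: "s < d \<Longrightarrow> 2 * marks D s \<le> zone"
proof -
  assume "s < d"
  then have "marks D s \<le> d * (d + 1) ^ (g - 1)"
    unfolding marks_def by (intro mult_le_mono power_increasing) auto
  then show ?thesis unfolding zone_def by simp
qed

text \<open>From 9 on, the residue modulo three separates original vertices and the two kinds of
  marks, and the quotient gives the block.\<close>

lemma shade_original:
  "shade e s = 9 + 3 * J \<longleftrightarrow> e mod K = 0 \<and> e div K div g = J"
proof -
  have "((if q = 0 then 9 + 3 * J' else if odd q then f else if q \<le> 2 * w then 10 + 3 * J'
      else if 2 * z < q \<and> q \<le> 2 * z + 2 * w then 11 + 3 * J' else 8) = 9 + 3 * J) \<longleftrightarrow>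
      q = 0 \<and> J' = J" if "f < 8" for q J' f w z :: nat
    using that by (cases "q = 0"; cases "odd q"; cases "q \<le> 2 * w"; auto; presburger)
  from this[OF letters] show ?thesis unfolding shade_def Let_def .
qed

lemma shade_filler:
  assumes "a < 8"
  shows "shade e s = a \<longleftrightarrow> odd (e mod K) \<and> u (e mod K div 2) = a"
proof -
  have "((if q = 0 then 9 + 3 * J' else if odd q then f else if q \<le> 2 * w then 10 + 3 * J'
      else if 2 * z < q \<and> q \<le> 2 * z + 2 * w then 11 + 3 * J' else 8) = a) \<longleftrightarrow> odd q \<and> f = a"
    for q J' f w z :: nat
    using assms by (cases "q = 0"; cases "odd q"; auto)
  from this show ?thesis unfolding shade_def Let_def .
qed

text \<open>By \<open>marks_le\<close> the first range of marks ends before the second begins, so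
  the nested conditions of \<open>shade\<close> reduce to one formula for both kinds.\<close>

lemma marked_iff:
  assumes "i < 2" "\<sigma> (e div K) < d"
  shows "e \<in> marked i J \<sigma> \<longleftrightarrow> e div K div g = J \<and> even (e mod K) \<and>
    2 * zone * i < e mod K \<and> e mod K \<le> 2 * zone * i + 2 * marks (e div K) (\<sigma> (e div K))"
proof -
  have "((if q = 0 then 9 + 3 * J' else if odd q then f else if q \<le> 2 * w then 10 + 3 * J'
      else if 2 * z < q \<and> q \<le> 2 * z + 2 * w then 11 + 3 * J' else 8) = 10 + i + 3 * J) \<longleftrightarrow>
      J' = J \<and> even q \<and> 2 * z * i < q \<and> q \<le> 2 * z * i + 2 * w"
    if "f < 8" "2 * w \<le> z" for q J' f w z :: nat
  proof -
    consider "i = 0" | "i = 1" using assms(1) by linarith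
    then show ?thesis
    proof cases
      case 1
      show ?thesis using that unfolding 1
        by (cases "q = 0"; cases "odd q"; cases "q \<le> 2 * w"; auto; presburger)
    next
      case 2
      show ?thesis using that unfolding 2
        by (cases "q = 0"; cases "odd q"; cases "q \<le> 2 * w"; auto; presburger)
    qed
  qed
  from this[OF letters marks_le[OF assms(2)]] show ?thesis
    unfolding marked_def mem_Collect_eq shade_def Let_def .
qed

section \<open>Counting the marks of one kind on a chain\<close>

context
  fixes \<sigma> :: "nat \<Rightarrow> nat" and J i :: nat
  assumes \<sigma>: "\<And>D. \<sigma> D < d" and i: "i < 2"
begin

lemma level_eq: "J * g \<le> D \<Longrightarrow> D < (J + 1) * g \<Longrightarrow> g - 1 - D mod g = (J + 1) * g - 1 - D"
proof -
  assume "J * g \<le> D" "D < (J + 1) * g"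
  then have "D div g = J" using g by (metis Suc_eq_plus1 div_nat_eqI mult.commute)
  then have "D mod g = D - J * g" using minus_div_mult_eq_mod by (metis)
  then show ?thesis using \<open>J * g \<le> D\<close> by simp
qed

lemma div_eq_iff: "D div g = J \<longleftrightarrow> J * g \<le> D \<and> D < (J + 1) * g"
  using g by (metis Suc_eq_plus1 div_nat_eqI div_times_less_eq_dividend dividend_less_div_times
      add.commute mult.commute mult_Suc less_le_trans zero_less_one)

text \<open>Level \<open>C\<close> contributes at most \<open>d * (d + 1) ^ (T - 1 - C)\<close>
  marks, where \<open>T\<close> is the end of the block, and the sum telescopes. With
  \<open>D\<close> one level below an edge, this says that all lower edges together weigh less than
  one unit of that edge.\<close>

lemma card_marked_less:
  assumes "finite S" "J * g \<le> D" "D \<le> (J + 1) * g"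
    and "\<And>e. e \<in> S \<Longrightarrow> e \<in> marked i J \<sigma> \<Longrightarrow> D \<le> e div K"
  shows "card (S \<inter> marked i J \<sigma>) < (d + 1) ^ ((J + 1) * g - D)"
proof -
  define T where "T = (J + 1) * g"
  define F where "F C = (\<lambda>m. C * K + 2 * zone * i + 2 * m) ` {1..marks C (\<sigma> C)}" for C
  have "S \<inter> marked i J \<sigma> \<subseteq> (\<Union>C \<in> {D..<T}. F C)"
  proof
    fix e assume e: "e \<in> S \<inter> marked i J \<sigma>"
    define C where "C = e div K"
    have *: "C div g = J" "even (e mod K)" "2 * zone * i < e mod K"
        "e mod K \<le> 2 * zone * i + 2 * marks C (\<sigma> C)"
      using e \<sigma> i by (auto simp: marked_iff C_def)
    then have "D \<le> C" "C < T" using assms(4)[of e] e unfolding C_def T_def div_eq_iff by auto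
    define m where "m = (e mod K - 2 * zone * i) div 2"
    have "even (e mod K - 2 * zone * i)" using *(2) by simp
    then have m2: "2 * m = e mod K - 2 * zone * i" unfolding m_def by simp
    then have "m \<in> {1..marks C (\<sigma> C)}" using *(3,4) by auto
    moreover have "e = C * K + 2 * zone * i + 2 * m"
      using m2 *(3) div_mult_mod_eq[of e K] unfolding C_def by linarith
    ultimately have "e \<in> F C" unfolding F_def by blast
    then show "e \<in> (\<Union>C \<in> {D..<T}. F C)" using \<open>D \<le> C\<close> \<open>C < T\<close> by auto
  qed
  then have "card (S \<inter> marked i J \<sigma>) \<le> card (\<Union>C \<in> {D..<T}. F C)"
    by (intro card_mono) (auto simp: F_def)
  also have "\<dots> \<le> (\<Sum>C = D..<T. card (F C))" by (intro card_UN_le) simp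
  also have "\<dots> \<le> (\<Sum>C = D..<T. d * (d + 1) ^ (T - 1 - C))"
  proof (rule sum_mono)
    fix C assume C: "C \<in> {D..<T}"
    have "card (F C) \<le> marks C (\<sigma> C)" unfolding F_def by (rule order.trans[OF card_image_le]) auto
    also have "\<dots> \<le> d * (d + 1) ^ (T - 1 - C)"
      using C assms(2) level_eq[of C] \<sigma>[of C] unfolding marks_def T_def by (intro mult_le_mono) auto
    finally show "card (F C) \<le> d * (d + 1) ^ (T - 1 - C)" .
  qed
  also have "\<dots> < (d + 1) ^ (T - D)"
    using geometric_sum_interval[of D T d] assms(3) unfolding T_def by simp
  finally show ?thesis unfolding T_def .
qed

text \<open>The edge at level \<open>D\<close> accounts for \<open>\<sigma> D + 1\<close> units and
  all lower edges for less than one.\<close>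

lemma card_marked_less_top:
  assumes "finite S" "J * g \<le> D" "D < (J + 1) * g"
    and "\<And>e. e \<in> S \<Longrightarrow> e \<in> marked i J \<sigma> \<Longrightarrow> D \<le> e div K"
  shows "card (S \<inter> marked i J \<sigma>) < (\<sigma> D + 2) * (d + 1) ^ ((J + 1) * g - 1 - D)"
proof -
  define S1 where "S1 = {e \<in> S. e div K = D}"
  define w where "w = marks D (\<sigma> D)"
  have "S1 \<inter> marked i J \<sigma> \<subseteq> (\<lambda>m. D * K + 2 * zone * i + 2 * m) ` {1..w}"
  proof
    fix e assume e: "e \<in> S1 \<inter> marked i J \<sigma>"
    have *: "even (e mod K)" "2 * zone * i < e mod K" "e mod K \<le> 2 * zone * i + 2 * w" "e div K = D"
      using e \<sigma> i by (auto simp: marked_iff S1_def w_def)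
    define m where "m = (e mod K - 2 * zone * i) div 2"
    have "even (e mod K - 2 * zone * i)" using *(1) by simp
    then have m2: "2 * m = e mod K - 2 * zone * i" unfolding m_def by simp
    then have "m \<in> {1..w}" using *(2,3) by auto
    moreover have "e = D * K + 2 * zone * i + 2 * m"
      using m2 *(2,4) div_mult_mod_eq[of e K] by auto
    ultimately show "e \<in> (\<lambda>m. D * K + 2 * zone * i + 2 * m) ` {1..w}" by blast
  qed
  then have "card (S1 \<inter> marked i J \<sigma>) \<le> card ((\<lambda>m. D * K + 2 * zone * i + 2 * m) ` {1..w})"
    by (rule card_mono[rotated]) simp
  also have "\<dots> \<le> w" by (rule order.trans[OF card_image_le]) auto
  finally have 1: "card (S1 \<inter> marked i J \<sigma>) \<le> w" .
  have 2: "card ((S - S1) \<inter> marked i J \<sigma>) < (d + 1) ^ ((J + 1) * g - Suc D)"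
    using assms by (intro card_marked_less) (force simp: S1_def Suc_le_eq le_less)+
  have "card (S \<inter> marked i J \<sigma>) \<le> card (S1 \<inter> marked i J \<sigma>) + card ((S - S1) \<inter> marked i J \<sigma>)"
    by (rule order.trans[OF card_mono card_Un_le]) (use assms(1) in \<open>auto simp: S1_def\<close>)
  with 1 2 show ?thesis
    using level_eq[OF assms(2,3)] unfolding w_def marks_def by (simp add: algebra_simps)
qed

text \<open>If \<open>S\<close> covers the zone of kind \<open>i\<close> on an edge, it has all
  marks of that kind there, whatever the child index.\<close>

lemma card_marked_ge:
  assumes "finite S" "J * g \<le> D" "D < (J + 1) * g" "2 * zone * i + zone < K"
    and "\<And>q. 2 * zone * i < q \<Longrightarrow> q \<le> 2 * zone * i + zone \<Longrightarrow> D * K + q \<in> S"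
  shows "(\<sigma> D + 1) * (d + 1) ^ ((J + 1) * g - 1 - D) \<le> card (S \<inter> marked i J \<sigma>)"
proof -
  define w where "w = marks D (\<sigma> D)"
  have w: "2 * w \<le> zone" unfolding w_def using marks_le \<sigma> by simp
  have "(\<lambda>m. D * K + (2 * zone * i + 2 * m)) ` {1..w} \<subseteq> S \<inter> marked i J \<sigma>"
  proof (rule image_subsetI)
    fix m assume m: "m \<in> {1..w}"
    define e where "e = D * K + (2 * zone * i + 2 * m)"
    have "e div K = D" "e mod K = 2 * zone * i + 2 * m"
      using m w assms(4) by (auto simp: e_def)
    then have "e \<in> marked i J \<sigma>"
      using m i \<sigma> assms(2,3) div_eq_iff[of D] by (subst marked_iff) (auto simp: w_def)
    then show "D * K + (2 * zone * i + 2 * m) \<in> S \<inter> marked i J \<sigma>"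
      using assms(5)[of "2 * zone * i + 2 * m"] m w unfolding e_def by auto
  qed
  then have "card ((\<lambda>m. D * K + (2 * zone * i + 2 * m)) ` {1..w}) \<le> card (S \<inter> marked i J \<sigma>)"
    using assms(1) by (intro card_mono) auto
  moreover have "card ((\<lambda>m. D * K + (2 * zone * i + 2 * m)) ` {1..w}) = w"
    by (subst card_image) (auto simp: inj_on_def)
  ultimately show ?thesis
    using level_eq[OF assms(2,3)] unfolding w_def marks_def by simp
qed

end

section \<open>Unbalanced halves of paths along chains\<close>

text \<open>Comparing the filler colours suffices: on the odd positions, balanced halves would be
  adjacent factors of \<open>u\<close> with equal letter counts.\<close>

lemma no_anagram_inside_edge:
  assumes le: "E \<le> c" "c \<le> Er" and inside: "E div K = D" "Er div K = D"
    and eq: "\<And>x. card {e \<in> {c<..Er}. hue \<sigma> e = x} = card {e \<in> {E..c}. hue \<sigma> e = x}"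
    and len: "Er - c = c - E + 1"
  shows False
proof -
  define \<alpha> \<beta> \<gamma> where "\<alpha> = E - D * K" and "\<beta> = c + 1 - D * K" and "\<gamma> = Er + 1 - D * K"
  have DK: "D * K \<le> E" "Er < D * K + K"
    using inside K div_times_less_eq_dividend[of E K] dividend_less_div_times[of K Er] by (auto simp: add.commute)
  have abc: "\<alpha> < \<beta>" "\<beta> \<le> \<gamma>" "\<gamma> \<le> K" "\<gamma> \<ge> \<alpha> + 2"
    and intervals: "{E..c} = {D * K + \<alpha>..<D * K + \<beta>}" "{c<..Er} = {D * K + \<beta>..<D * K + \<gamma>}"
    using le DK len unfolding \<alpha>_def \<beta>_def \<gamma>_def by auto
  \<comment> \<open>An odd position \<open>2 * i + 1\<close> lies in \<open>{a..<b}\<close> exactly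
    if \<open>i\<close> lies in \<open>{a div 2..<b div 2}\<close>.\<close>
  have count: "card {e \<in> {D * K + a..<D * K + b}. hue \<sigma> e = x} = count (mset (map u [a div 2..<b div 2])) x"
    if "b \<le> K" "x < 8" for a b x
  proof -
    have "{e \<in> {D * K + a..<D * K + b}. hue \<sigma> e = x}
        = (\<lambda>i. D * K + (2 * i + 1)) ` {i \<in> {a div 2..<b div 2}. u i = x}" (is "?L = ?R")
    proof (intro equalityI subsetI)
      fix e assume e: "e \<in> ?L"
      define q where "q = e - D * K"
      have q: "e = D * K + q" "a \<le> q" "q < b" using e by (auto simp: q_def)
      then have "e mod K = q" using that(1) by simp
      then have "odd q" "u (q div 2) = x" using e shade_filler[OF that(2)] by auto
      then have "e = D * K + (2 * (q div 2) + 1)" "q div 2 \<in> {i \<in> {a div 2..<b div 2}. u i = x}"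
        using q by (auto elim!: oddE)
      then show "e \<in> ?R" by blast
    next
      fix e assume "e \<in> ?R"
      then obtain i where i: "e = D * K + (2 * i + 1)" "a div 2 \<le> i" "i < b div 2" "u i = x" by auto
      then have "2 * i + 1 < b" "a \<le> 2 * i + 1" by linarith+
      then have "2 * i + 1 < K" using that(1) by simp
      then have "e mod K = 2 * i + 1" "e div K = D" unfolding i(1) by (rule mult_add_mod_less mult_add_div_less)+
      then have "hue \<sigma> e = x" using shade_filler[OF that(2)] i(4) by simp
      then show "e \<in> ?L" using i(1) \<open>2 * i + 1 < b\<close> \<open>a \<le> 2 * i + 1\<close> by simp
    qed
    then have "card {e \<in> {D * K + a..<D * K + b}. hue \<sigma> e = x} = card {i \<in> {a div 2..<b div 2}. u i = x}"
      by (simp add: card_image inj_on_def)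
    also have "\<dots> = count (mset (map u [a div 2..<b div 2])) x"
      using count_image_mset_set[of "{a div 2..<b div 2}" u x] by (simp add: Int_def)
    finally show ?thesis .
  qed
  have "mset (map u [\<beta> div 2..<\<gamma> div 2]) = mset (map u [\<alpha> div 2..<\<beta> div 2])"
  proof (rule multiset_eqI)
    fix x
    show "count (mset (map u [\<beta> div 2..<\<gamma> div 2])) x = count (mset (map u [\<alpha> div 2..<\<beta> div 2])) x"
    proof (cases "x < 8")
      case True
      then show ?thesis using eq[of x] count[of \<gamma> x \<beta>] count[of \<beta> x \<alpha>] abc unfolding intervals by simp
    next
      case False
      then have "u i \<noteq> x" for i using letters[of i] by auto
      then have "x \<notin> set (map u [a..<b])" for a b by auto
      then show ?thesis by (metis count_mset_0_iff)
    qed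
  qed
  moreover from this have "\<gamma> div 2 - \<beta> div 2 = \<beta> div 2 - \<alpha> div 2"
    by (metis length_map length_upt size_mset)
  \<comment> \<open>At least two consecutive positions contain an odd one, and the halves have
    equally many, so the first half has a filler.\<close>
  then have "\<alpha> div 2 < \<beta> div 2" using abc by linarith
  ultimately show False using fillers[of "\<alpha> div 2" "\<beta> div 2" "\<gamma> div 2"] abc by simp linarith
qed

text \<open>A path with top depth \<open>E\<close> whose longer side ends at depth \<open>Er\<close> has its midpoint just
  below depth \<open>c\<close> on that side; \<open>\<sigma>\<close> and \<open>\<rho>\<close> are the child indices on the two sides.\<close>

theorem no_anagram_on_chains:
  assumes \<sigma>: "\<And>D. \<sigma> D < d" and \<rho>: "\<And>D. \<rho> D < d"
    and le: "E \<le> c" "c \<le> Er" "E \<le> El"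
    and turn: "El = E \<or> E mod K = 0 \<and> \<sigma> (E div K) \<noteq> \<rho> (E div K)"
    and eq: "image_mset (hue \<sigma>) (mset_set {c<..Er})
      = image_mset (hue \<rho>) (mset_set {E<..El}) + image_mset (hue \<sigma>) (mset_set {E..c})"
  shows False
proof -
  have len: "Er - c = (El - E) + (c - E + 1)"
    using arg_cong[OF eq, of size] le by simp
  have cnt: "card ({c<..Er} \<inter> {e. hue \<sigma> e = x})
      = card ({E<..El} \<inter> {e. hue \<rho> e = x}) + card ({E..c} \<inter> {e. hue \<sigma> e = x})" for x
    using arg_cong[OF eq, of "\<lambda>M. count M x"] by (simp add: count_image_mset_set)
  show False
  proof (cases "\<exists>D. E \<le> D * K \<and> D * K \<le> Er")
    case False
    \<comment> \<open>Without an original vertex the longer side stays inside one edge. A proper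
      turn would be an original vertex, so the shorter side is empty.\<close>
    have "E div K = Er div K"
    proof (rule ccontr)
      assume "E div K \<noteq> Er div K"
      then have "E div K < Er div K" using le by (meson div_le_mono le_neq_implies_less order.trans)
      then have "E < Er div K * K" using K by (simp add: div_less_iff_less_mult)
      then show False using False by (meson div_times_less_eq_dividend less_imp_le)
    qed
    moreover have "El = E"
      using turn False le by (metis div_mult_mod_eq add.right_neutral le_trans order_refl)
    ultimately show False
      using no_anagram_inside_edge[OF le(1,2) refl, of \<sigma>] cnt len by (simp add: Int_def)
  next
    case True
    \<comment> \<open>The uppermost original vertex on the longer side is at level
      \<open>D0\<close>, in block \<open>J\<close>.\<close>
    define D0 where "D0 = (LEAST D. E \<le> D * K)"
    obtain D' where D': "E \<le> D' * K" "D' * K \<le> Er" using True by blast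
    have D0: "E \<le> D0 * K" unfolding D0_def by (rule LeastI[of _ D']) (rule D')
    have D0_least: "D0 \<le> D" if "E \<le> D * K" for D unfolding D0_def by (rule Least_le) (rule that)
    have D0_Er: "D0 * K \<le> Er" using D0_least[OF D'(1)] D'(2) by (meson le_trans mult_le_mono1)
    define J where "J = D0 div g"
    have D0_E: "D0 * K = E" if "El \<noteq> E"
      using turn that D0 D0_least[of "E div K"] by (metis div_mult_mod_eq add.right_neutral le_antisym mult_le_mono1 order_refl)
    have orig: "hue \<tau> e = 9 + 3 * J \<longleftrightarrow> e mod K = 0 \<and> e div K div g = J" for \<tau> e
      by (rule shade_original)
    have D0_hue: "hue \<tau> (D0 * K) = 9 + 3 * J" for \<tau>
      by (subst orig) (use K in \<open>simp add: J_def\<close>)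
    \<comment> \<open>If that vertex is above the cut, balance of its private colour forces another
      original vertex of block \<open>J\<close> below the cut.\<close>
    obtain D1 where D1: "c < D1 * K" "D1 * K \<le> Er" "D1 div g = J"
    proof (cases "D0 * K \<le> c")
      case False
      then show thesis using that[of D0] D0_Er J_def by simp
    next
      case True
      then have "D0 * K \<in> {E..c} \<inter> {e. hue \<sigma> e = 9 + 3 * J}" using D0 D0_hue by simp
      then have "card ({E..c} \<inter> {e. hue \<sigma> e = 9 + 3 * J}) > 0" by (auto simp: card_gt_0_iff)
      then have "card ({c<..Er} \<inter> {e. hue \<sigma> e = 9 + 3 * J}) > 0" using cnt[of "9 + 3 * J"] by simp
      then obtain e where "e \<in> {c<..Er} \<inter> {e. hue \<sigma> e = 9 + 3 * J}"
        by (metis card.empty equals0I less_irrefl)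
      then have "c < e" "e \<le> Er" "e mod K = 0" "e div K div g = J" using orig by auto
      then show thesis using that[of "e div K"] by (metis div_mult_mod_eq add.right_neutral)
    qed
    \<comment> \<open>Otherwise the shorter side would be empty and the first half without original
      vertices, but the second half has one of block \<open>J\<close>.\<close>
    have D0_c: "D0 * K \<le> c"
    proof (rule ccontr)
      assume nle: "\<not> D0 * K \<le> c"
      then have "El = E" using D0_E le by linarith
      moreover have no_orig: "e mod K \<noteq> 0" if "e \<in> {E..c}" for e
      proof
        assume "e mod K = 0"
        then have "e = e div K * K" by auto
        then have "D0 \<le> e div K" using that by (intro D0_least) simp
        then have "D0 * K \<le> e" using \<open>e = e div K * K\<close> by (metis mult_le_mono1)
        then show False using that nle by simp
      qed
      have "hue \<sigma> e \<noteq> 9 + 3 * J" if "e \<in> {E..c}" for e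
        using iffD1[OF orig[where \<tau> = \<sigma> and e = e]] no_orig[OF that] by blast
      then have "{E..c} \<inter> {e. hue \<sigma> e = 9 + 3 * J} = {}" by auto
      ultimately have "card ({c<..Er} \<inter> {e. hue \<sigma> e = 9 + 3 * J}) = 0" using cnt[of "9 + 3 * J"] by simp
      moreover have "D0 * K \<in> {c<..Er} \<inter> {e. hue \<sigma> e = 9 + 3 * J}" using nle D0_Er D0_hue by simp
      then have "card ({c<..Er} \<inter> {e. hue \<sigma> e = 9 + 3 * J}) > 0" by (auto simp: card_gt_0_iff)
      ultimately show False by linarith
    qed
    \<comment> \<open>The cut is in the edge below level \<open>Dm\<close>, at distance
      \<open>x\<close> from its upper end. Both ends of this middle edge lie on the longer side and
      in block \<open>J\<close>.\<close>
    define Dm x where "Dm = c div K" and "x = c mod K"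
    have c: "c = Dm * K + x" "x < K" unfolding Dm_def x_def using K by simp_all
    have "D0 \<le> Dm" unfolding Dm_def using D0_c K by (simp add: less_eq_div_iff_mult_less_eq)
    have "Dm < D1" using D1(1) K unfolding Dm_def by (simp add: div_less_iff_less_mult)
    then have Dm_Er: "(Dm + 1) * K \<le> Er" using D1(2) mult_le_mono1[of "Dm + 1" D1 K] by simp
    have J_iff: "D div g = J \<longleftrightarrow> J * g \<le> D \<and> D < (J + 1) * g" for D
      using div_eq_iff[of \<sigma> 0] \<sigma> by simp
    have block: "J * g \<le> D0" "D1 < (J + 1) * g" using J_def D1(3) J_iff by auto
    have "g \<ge> 2"
    proof (rule ccontr)
      assume "\<not> g \<ge> 2"
      then have "g = 1" using g by simp
      then show False using J_def D1(3) \<open>D0 \<le> Dm\<close> \<open>Dm < D1\<close> by simp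
    qed
    then have zone: "5 * zone < K" using room unfolding zone_def by simp
    \<comment> \<open>The unit of marks on the middle edge: child \<open>s\<close> gives
      \<open>(s + 1) * w\<close> marks of each kind, and all lower edges of the block together have
      fewer than \<open>w\<close>.\<close>
    define w where "w = (d + 1) ^ ((J + 1) * g - 1 - Dm)"
    have "w > 0" unfolding w_def by simp
    have w_Suc: "(d + 1) ^ ((J + 1) * g - Suc Dm) = w" unfolding w_def by simp
    have Dm_block: "J * g \<le> Dm" "Dm < (J + 1) * g" "Dm + 1 \<le> (J + 1) * g"
      using block \<open>D0 \<le> Dm\<close> \<open>Dm < D1\<close> by auto
    have div_ge: "Dm \<le> e div K" if "c < e" for e using that unfolding Dm_def by (simp add: div_le_mono)
    have hueD: "{e. hue \<tau> e = 10 + i + 3 * J} = marked i J \<tau>" for i \<tau> unfolding marked_def ..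
    have cnt': "card ({c<..Er} \<inter> marked i J \<sigma>)
        = card ({E<..El} \<inter> marked i J \<rho>) + card ({E..c} \<inter> marked i J \<sigma>)" for i
      using cnt[of "10 + i + 3 * J"] unfolding hueD .
    note iff0 = marked_iff[of 0 \<sigma>, OF _ \<sigma>, simplified] and iff1 = marked_iff[of 1 \<sigma>, OF _ \<sigma>, simplified]
    show False
    proof (cases "x \<ge> zone")
      case True
      \<comment> \<open>The cut is past the first zone: the marks of the first kind on the middle
        edge are all in the first half, and the second half has only those of lower edges.\<close>
      have "(\<sigma> Dm + 1) * w \<le> card ({E..c} \<inter> marked 0 J \<sigma>)"
        unfolding w_def
      proof (rule card_marked_ge[OF \<sigma>])
        fix q assume "2 * zone * 0 < q" "q \<le> 2 * zone * 0 + zone"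
        then have "q \<le> x" using True by simp
        moreover have "E \<le> Dm * K" using D0 \<open>D0 \<le> Dm\<close> by (meson le_trans mult_le_mono1)
        ultimately show "Dm * K + q \<in> {E..c}" using c by simp
      qed (use zone Dm_block in auto)
      moreover have "card ({c<..Er} \<inter> marked 0 J \<sigma>) < w"
        unfolding w_Suc[symmetric]
      proof (rule card_marked_less[OF \<sigma>])
        fix e assume e: "e \<in> {c<..Er}" "e \<in> marked 0 J \<sigma>"
        have "e div K \<noteq> Dm"
        proof
          assume eD: "e div K = Dm"
          then have "e mod K > x" using e(1) c div_mult_mod_eq[of e K] by auto
          moreover have "e mod K \<le> zone" using e(2) marks_le[of "\<sigma> Dm" Dm] \<sigma> eD by (fastforce simp: iff0)
          ultimately show False using True by simp
        qed
        then show "Suc Dm \<le> e div K" using div_ge[of e] e(1) by simp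
      qed (use Dm_block in auto)
      ultimately show False using cnt'[of 0] by simp
    next
      case False
      \<comment> \<open>The cut is before the second zone, so the marks of the second kind on the
        middle edge all fall into the second half.\<close>
      have right_ge: "(\<sigma> Dm + 1) * w \<le> card ({c<..Er} \<inter> marked 1 J \<sigma>)"
        unfolding w_def
      proof (rule card_marked_ge[OF \<sigma>])
        fix q assume "2 * zone * 1 < q" "q \<le> 2 * zone * 1 + zone"
        then show "Dm * K + q \<in> {c<..Er}" using c Dm_Er False zone by simp
      qed (use zone Dm_block in auto)
      have right_less: "card ({c<..Er} \<inter> marked 1 J \<sigma>) < (\<sigma> Dm + 2) * w"
        unfolding w_def
        by (rule card_marked_less_top[OF \<sigma>]) (use Dm_block div_ge in auto)
      also have "\<dots> \<le> (d + 1) * w" using \<sigma>[of Dm] by (intro mult_le_mono1) simp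
      finally have right_less': "card ({c<..Er} \<inter> marked 1 J \<sigma>) < (d + 1) * w" .
      \<comment> \<open>An edge one level higher in the same block has at least
        \<open>(d + 1) * w\<close> marks of the second kind, more than the whole second
        half.\<close>
      have big: False if "D + 1 = Dm" "J * g \<le> D"
        and in_left: "\<And>q. 2 * zone < q \<Longrightarrow> q \<le> 3 * zone \<Longrightarrow> D * K + q \<in> {E..c}" for D
      proof -
        have "(\<sigma> D + 1) * (d + 1) ^ ((J + 1) * g - 1 - D) \<le> card ({E..c} \<inter> marked 1 J \<sigma>)"
          by (rule card_marked_ge[OF \<sigma>]) (use that zone Dm_block in auto)
        moreover have "(J + 1) * g - 1 - D = Suc ((J + 1) * g - 1 - Dm)" using that(1) Dm_block by simp
        then have "(d + 1) * w = (d + 1) ^ ((J + 1) * g - 1 - D)" unfolding w_def by simp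
        ultimately have "(d + 1) * w \<le> card ({E..c} \<inter> marked 1 J \<sigma>)" by simp
        then show False using right_less' cnt'[of 1] by simp
      qed
      have mid_unmarked: "e \<notin> marked 1 J \<sigma>" if "e \<le> c" "e div K = Dm" for e
      proof -
        have "e mod K \<le> x" using that c div_mult_mod_eq[of e K] by (metis add_le_cancel_left)
        then show ?thesis using False by (simp add: iff1)
      qed
      \<comment> \<open>Either the edge above the middle one lies fully in the first half, or the
        path is vertical and starts no higher than inside that edge, or it turns at the upper end of
        the middle edge.\<close>
      consider (inner) "D0 < Dm" | (straight) "D0 = Dm" "El = E" | (bent) "D0 = Dm" "El \<noteq> E"
        using \<open>D0 \<le> Dm\<close> by linarith
      then show False
      proof cases
        case inner
        show False
        proof (rule big[of "Dm - 1"])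
          fix q assume "2 * zone < q" "q \<le> 3 * zone"
          moreover have "D0 * K \<le> (Dm - 1) * K" "(Dm - 1) * K + K = Dm * K"
            using inner mult_le_mono1[of D0 "Dm - 1" K] by (simp_all add: diff_mult_distrib)
          ultimately show "(Dm - 1) * K + q \<in> {E..c}"
            unfolding atLeastAtMost_iff using D0 c zone by linarith
        qed (use inner block in auto)
      next
        case straight
        \<comment> \<open>The second half has at least \<open>K - x\<close> vertices and the first
          half as many, so the path starts above the second zone of the edge above the middle
          one.\<close>
        have long: "E \<le> (D0 - 1) * K + 2 * zone" if "D0 > 0"
        proof -
          have "(D0 - 1) * K + K = D0 * K" using that by (simp add: diff_mult_distrib)
          moreover have "(Dm + 1) * K = Dm * K + K" "D0 * K = Dm * K" using straight by simp_all
          ultimately show ?thesis using len straight c Dm_Er False le by linarith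
        qed
        show False
        proof (cases "D0 > 0 \<and> J * g \<le> D0 - 1")
          case True
          show False
          proof (rule big[of "D0 - 1"])
            fix q assume "2 * zone < q" "q \<le> 3 * zone"
            moreover have "(D0 - 1) * K + K = D0 * K" using True by (simp add: diff_mult_distrib)
            ultimately show "(D0 - 1) * K + q \<in> {E..c}"
              unfolding atLeastAtMost_iff using long True D0_c zone by linarith
          qed (use True straight in auto)
        next
          case top: False
          \<comment> \<open>The edge above the middle one is missing or in another block, so the
            first half has no marks of the second kind for block \<open>J\<close>.\<close>
          have "e \<notin> marked 1 J \<sigma>" if e: "e \<in> {E..c}" for e
          proof
            assume m: "e \<in> marked 1 J \<sigma>"
            have "e div K \<le> Dm" unfolding Dm_def using e by (simp add: div_le_mono)
            then have "e div K < D0" using mid_unmarked m e straight by fastforce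
            moreover have "D0 \<le> e div K + 1"
            proof (rule D0_least)
              show "E \<le> (e div K + 1) * K" using e K dividend_less_div_times[of K e] by simp
            qed
            ultimately have "e div K = D0 - 1" "D0 > 0" by auto
            moreover have "J * g \<le> e div K" using m J_iff by (simp add: iff1)
            ultimately show False using top by simp
          qed
          then have "{E..c} \<inter> marked 1 J \<sigma> = {}" by blast
          then show False using right_ge cnt'[of 1] straight \<open>w > 0\<close> by simp
        qed
      next
        case bent
        have E: "E = D0 * K" using D0_E bent by simp
        \<comment> \<open>The second half and the shorter side have equally many marks of the second
          kind. Each count is at least \<open>s + 1\<close> and less than \<open>s + 2\<close> units
          for its own child index \<open>s\<close>, which forces equal indices.\<close>
        have ne: "\<sigma> Dm \<noteq> \<rho> Dm" using turn bent K unfolding E by auto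
        have "e \<notin> marked 1 J \<sigma>" if "e \<in> {E..c}" for e
        proof (rule mid_unmarked)
          show "e div K = Dm"
          proof (rule antisym)
            show "e div K \<le> Dm" unfolding Dm_def using that by (simp add: div_le_mono)
            have "Dm * K \<le> e" using that E bent by simp
            then show "Dm \<le> e div K" using K by (simp add: less_eq_div_iff_mult_less_eq)
          qed
        qed (use that in simp)
        then have "{E..c} \<inter> marked 1 J \<sigma> = {}" by blast
        then have eq1: "card ({c<..Er} \<inter> marked 1 J \<sigma>) = card ({E<..El} \<inter> marked 1 J \<rho>)"
          using cnt'[of 1] by simp
        have "(\<rho> Dm + 1) * w \<le> card ({E<..El} \<inter> marked 1 J \<rho>)"
          unfolding w_def
        proof (rule card_marked_ge[OF \<rho>])
          fix q assume "2 * zone * 1 < q" "q \<le> 2 * zone * 1 + zone"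
          \<comment> \<open>The shorter side extends more than \<open>K - 2 * zone\<close> below the
            turn, which covers \<open>3 * zone\<close> because \<open>5 * zone < K\<close>.\<close>
          then show "Dm * K + q \<in> {E<..El}" using len E c Dm_Er bent False zone le by simp
        qed (use zone Dm_block in auto)
        moreover have "card ({E<..El} \<inter> marked 1 J \<rho>) < (\<rho> Dm + 2) * w"
          unfolding w_def
        proof (rule card_marked_less_top[OF \<rho>])
          fix e assume "e \<in> {E<..El}"
          then have "Dm * K \<le> e" using E bent by simp
          then show "Dm \<le> e div K" using K by (simp add: less_eq_div_iff_mult_less_eq)
        qed (use Dm_block in auto)
        ultimately have "(\<sigma> Dm + 1) * w < (\<rho> Dm + 2) * w" "(\<rho> Dm + 1) * w < (\<sigma> Dm + 2) * w"
          using right_ge right_less eq1 by linarith+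
        then have "\<sigma> Dm + 1 < \<rho> Dm + 2" "\<rho> Dm + 1 < \<sigma> Dm + 2" by (meson mult_less_cancel2)+
        then show False using ne by simp
      qed
    qed
  qed
qed

end

section \<open>Paths in subdivided trees\<close>

text \<open>Child indices are listed upwards, so the ancestor at depth \<open>D\<close> is a suffix.
  For \<open>D\<close> beyond the length it is \<open>xs\<close> itself.\<close>

definition ancestor :: "'a list \<Rightarrow> nat \<Rightarrow> 'a list" where
  "ancestor xs D = drop (length xs - D) xs"

lemma length_ancestor: "D \<le> length xs \<Longrightarrow> length (ancestor xs D) = D"
  by (simp add: ancestor_def)

lemma ancestor_self [simp]: "ancestor xs (length xs) = xs"
  by (simp add: ancestor_def)

lemma ancestor_append: "ancestor (xs @ ys) (length ys) = ys"
  by (simp add: ancestor_def)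

lemma ancestor_Suc: "D < length xs \<Longrightarrow> ancestor xs (Suc D) = rev xs ! D # ancestor xs D"
  using Cons_nth_drop_Suc[of "length xs - Suc D" xs]
  by (simp add: ancestor_def rev_nth Suc_diff_Suc)

lemma ancestor_mono_cong:
  assumes "ancestor xs D = ancestor ys D" "D' \<le> D" "D \<le> length xs" "D \<le> length ys"
  shows "ancestor xs D' = ancestor ys D'"
proof -
  have "ancestor zs D' = drop (D - D') (ancestor zs D)" if "D \<le> length zs" for zs :: "'a list"
    using that assms(2) by (simp add: ancestor_def)
  then show ?thesis using assms by metis
qed

lemma set_ancestor: "set (ancestor xs D) \<subseteq> set xs"
  by (simp add: ancestor_def set_drop_subset)

locale subdivided_tree =
  fixes d h k K :: nat
  assumes K_eq: "K = k + 1"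
begin

lemma K_pos [simp]: "0 < K" and less_K_iff: "i < K \<longleftrightarrow> i \<le> k"
  using K_eq by auto

lemma K_neq [simp]: "K \<noteq> 0"
  using K_eq by simp

lemma subdiv_vertex_K: "subdiv_vertex k u v i =
    (if i = 0 then Orig u else if i = K then Orig v else Division {(u, i), (v, K - i)})"
  unfolding subdiv_vertex_def K_eq ..

lemma subdiv_vertex_sym: "i \<le> K \<Longrightarrow> subdiv_vertex k u v i = subdiv_vertex k v u (K - i)"
  by (auto simp: subdiv_vertex_K)

abbreviation S :: "nat list subdiv graph" where "S \<equiv> subdivision k (complete_tree d h)"

definition node :: "nat list \<Rightarrow> bool" where
  "node xs \<longleftrightarrow> set xs \<subseteq> {..<d} \<and> length xs \<le> h"

text \<open>The vertex at distance \<open>e\<close> from the root on the path to the node \<open>xs\<close>.\<close>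

definition spot :: "nat list \<Rightarrow> nat \<Rightarrow> nat list subdiv" where
  "spot xs e = subdiv_vertex k (ancestor xs (e div K)) (ancestor xs (Suc (e div K))) (e mod K)"

lemma spot_original: "e mod K = 0 \<Longrightarrow> spot xs e = Orig (ancestor xs (e div K))"
  by (simp add: spot_def subdiv_vertex_K)

lemma spot_on_edge:
  assumes "i \<le> K"
  shows "spot xs (D * K + i) = subdiv_vertex k (ancestor xs D) (ancestor xs (Suc D)) i"
proof (cases "i = K")
  case True
  then have "D * K + i = Suc D * K" by simp
  then show ?thesis unfolding spot_def True by (simp add: subdiv_vertex_K del: mult_Suc)
next
  case False
  then have "(D * K + i) div K = D" "(D * K + i) mod K = i" using assms by simp_all
  then show ?thesis unfolding spot_def by simp
qed

lemma div_less_if: "e < K * n \<Longrightarrow> e div K < n"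
  by (simp add: div_less_iff_less_mult mult.commute)

lemma edge_iff: "{u, v} \<in> edges (complete_tree d h) \<longleftrightarrow>
    (\<exists>xs i. node (i # xs) \<and> (u = xs \<and> v = i # xs \<or> u = i # xs \<and> v = xs))"
  unfolding complete_tree_def node_def by (fastforce simp: doubleton_eq_iff)

lemma node_ancestor: "node xs \<Longrightarrow> node (ancestor xs D)"
  using set_ancestor[of xs D] unfolding node_def by (force simp: ancestor_def)

lemma tree_edge: "node xs \<Longrightarrow> D < length xs \<Longrightarrow>
    {ancestor xs D, ancestor xs (Suc D)} \<in> edges (complete_tree d h)"
  using node_ancestor[of xs "Suc D"] unfolding edge_iff by (metis ancestor_Suc)

lemma spot_edge:
  assumes "node xs" "e < K * length xs"
  shows "{spot xs e, spot xs (Suc e)} \<in> edges S"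
proof -
  define D i where "D = e div K" and "i = e mod K"
  have e: "e = D * K + i" "i \<le> k" by (simp_all add: D_def i_def flip: less_K_iff)
  have "D < length xs" using assms(2) unfolding D_def by (rule div_less_if)
  then have "{ancestor xs D, ancestor xs (Suc D)} \<in> edges (complete_tree d h)"
    using assms(1) by (rule tree_edge[rotated])
  moreover have "spot xs e = subdiv_vertex k (ancestor xs D) (ancestor xs (Suc D)) i"
      "spot xs (Suc e) = subdiv_vertex k (ancestor xs D) (ancestor xs (Suc D)) (i + 1)"
    using spot_on_edge[of i xs D] spot_on_edge[of "Suc i" xs D] e K_eq by auto
  ultimately show ?thesis using e(2) unfolding subdivision_def by auto
qed

lemma spot_vertex:
  assumes "node xs" "e \<le> K * length xs"
  shows "spot xs e \<in> verts S"
proof (cases "e mod K = 0")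
  case True
  then show ?thesis
    using node_ancestor[OF assms(1), of "e div K"]
    by (simp add: spot_original subdivision_def complete_tree_def node_def)
next
  case False
  then have "e < K * length xs" using assms(2) by (metis le_neq_implies_less mod_mult_self1_is_0)
  then have "{ancestor xs (e div K), ancestor xs (Suc (e div K))} \<in> edges (complete_tree d h)"
    using assms(1) div_less_if tree_edge by blast
  moreover have "1 \<le> e mod K" "e mod K \<le> k" using False by (simp_all flip: less_K_iff)
  ultimately show ?thesis unfolding spot_def subdivision_def fst_conv by blast
qed

lemma edge_spot_sub:
  assumes "node (j # ys)" "i \<le> K"
  shows "subdiv_vertex k ys (j # ys) i = spot (j # ys) (length ys * K + i)"
  using spot_on_edge[OF assms(2), of "j # ys" "length ys"] ancestor_append[of "[j]" ys]
    ancestor_self[of "j # ys"] by simp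

lemma verts_tree: "verts (complete_tree d h) = {xs. node xs}"
  unfolding complete_tree_def node_def by simp

lemma vertexE:
  assumes "v \<in> verts S"
  obtains xs e where "node xs" "e \<le> K * length xs" "v = spot xs e"
proof -
  consider xs where "node xs" "v = Orig xs"
    | u w i where "v = subdiv_vertex k u w i" "{u, w} \<in> edges (complete_tree d h)" "i \<le> k"
    using assms unfolding subdivision_def fst_conv verts_tree by auto
  then show thesis
  proof cases
    case 1
    have "(K * length xs) mod K = 0" "K * length xs div K = length xs" by simp_all
    then show thesis using that[of xs "K * length xs"] 1 spot_original[of "K * length xs" xs] by simp
  next
    case 2
    then obtain ys j where ys: "node (j # ys)" "u = ys \<and> w = j # ys \<or> u = j # ys \<and> w = ys"
      unfolding edge_iff by blast
    then obtain i' where "i' \<le> K" "v = subdiv_vertex k ys (j # ys) i'"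
      using 2(1,3) subdiv_vertex_sym[of i u w] K_eq by (metis Suc_eq_plus1 diff_le_self le_SucI)
    then show thesis using that[of "j # ys" "length ys * K + i'"] edge_spot_sub[OF ys(1)] ys(1) by simp
  qed
qed

lemma edgeE:
  assumes "X \<in> edges S"
  obtains xs e where "node xs" "e < K * length xs" "X = {spot xs e, spot xs (Suc e)}"
proof -
  obtain u w i where X: "X = {subdiv_vertex k u w i, subdiv_vertex k u w (i + 1)}"
      "{u, w} \<in> edges (complete_tree d h)" "i \<le> k"
    using assms unfolding subdivision_def by auto
  then obtain ys j where ys: "node (j # ys)" "u = ys \<and> w = j # ys \<or> u = j # ys \<and> w = ys"
    unfolding edge_iff by blast
  have "\<exists>i' \<le> k. X = {subdiv_vertex k ys (j # ys) i', subdiv_vertex k ys (j # ys) (i' + 1)}"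
    using ys(2)
  proof
    assume uw: "u = j # ys \<and> w = ys"
    \<comment> \<open>Distances \<open>i\<close> and \<open>i + 1\<close> from the lower end are
      distances \<open>k + 1 - i\<close> and \<open>k - i\<close> from the upper end.\<close>
    have "X = {subdiv_vertex k ys (j # ys) (k - i), subdiv_vertex k ys (j # ys) (k - i + 1)}"
      using X uw subdiv_vertex_sym[of i u w] subdiv_vertex_sym[of "i + 1" u w] K_eq
      by (auto simp: Suc_diff_le)
    then show ?thesis by (intro exI[of _ "k - i"]) simp
  qed (use X in auto)
  then obtain i' where i': "i' \<le> k"
    "X = {subdiv_vertex k ys (j # ys) i', subdiv_vertex k ys (j # ys) (i' + 1)}" by blast
  then have "X = {spot (j # ys) (length ys * K + i'), spot (j # ys) (Suc (length ys * K + i'))}"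
    using edge_spot_sub[OF ys(1), of i'] edge_spot_sub[OF ys(1), of "i' + 1"] K_eq by simp
  then show thesis using that[of "j # ys" "length ys * K + i'"] ys(1) i'(1) K_eq by simp
qed

lemma spot_cong:
  assumes "ancestor xs D = ancestor ys D" "D \<le> length xs" "D \<le> length ys" "e \<le> K * D"
  shows "spot xs e = spot ys e"
proof (cases "e = K * D")
  case True
  then show ?thesis using assms(1) by (simp add: spot_def subdiv_vertex_K)
next
  case False
  then have "e div K < D" using assms(4) by (intro div_less_if) simp
  then have "ancestor xs (e div K) = ancestor ys (e div K)"
      "ancestor xs (Suc (e div K)) = ancestor ys (Suc (e div K))"
    using assms(1-3) by (auto intro: ancestor_mono_cong)
  then show ?thesis unfolding spot_def by simp
qed

text \<open>Lengths of ancestors reveal the depth. A division vertex also determines the lower end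
  of its edge, whereas an original vertex determines only itself and its ancestors.\<close>

lemma spot_eqD:
  assumes "e \<le> K * length xs" "e' \<le> K * length ys" and eq: "spot xs e = spot ys e'"
  shows "e = e'" and "e mod K = 0 \<Longrightarrow> ancestor xs (e div K) = ancestor ys (e div K)"
    and "e mod K \<noteq> 0 \<Longrightarrow> e div K < length xs \<and> e div K < length ys \<and>
      ancestor xs (Suc (e div K)) = ancestor ys (Suc (e div K))"
proof -
  have len: "length (ancestor xs (e div K)) = e div K" "length (ancestor ys (e' div K)) = e' div K"
    using assms(1,2) div_le_mono[of e "K * length xs" K] div_le_mono[of e' "K * length ys" K]
    by (simp_all add: length_ancestor)
  have slen: "e div K < length xs" if "e mod K \<noteq> 0" "e \<le> K * length xs" for e and xs :: "nat list"
    using that by (intro div_less_if) (metis le_neq_implies_less mod_mult_self1_is_0)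
  have bound: "e mod K \<noteq> K" "e' mod K \<noteq> K" using mod_less_divisor[of K] K_pos by (metis less_irrefl)+
  consider "e mod K = 0" "e' mod K = 0" "ancestor xs (e div K) = ancestor ys (e' div K)"
    | "e mod K \<noteq> 0" "e' mod K \<noteq> 0"
      "{(ancestor xs (e div K), e mod K), (ancestor xs (Suc (e div K)), K - e mod K)}
        = {(ancestor ys (e' div K), e' mod K), (ancestor ys (Suc (e' div K)), K - e' mod K)}"
    using eq bound unfolding spot_def subdiv_vertex_K by (auto split: if_splits)
  then have *: "e = e' \<and> (e mod K = 0 \<longrightarrow> ancestor xs (e div K) = ancestor ys (e div K)) \<and>
    (e mod K \<noteq> 0 \<longrightarrow> e div K < length xs \<and> e div K < length ys \<and>
      ancestor xs (Suc (e div K)) = ancestor ys (Suc (e div K)))"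
  proof cases
    case 1
    then have "e div K = e' div K" using len by metis
    then have "e = e'" using 1 by (metis div_mult_mod_eq)
    then show ?thesis using 1 by simp
  next
    case 2
    have l: "e div K < length xs" "e' div K < length ys" using slen 2 assms by auto
    then have "length (ancestor xs (Suc (e div K))) = Suc (e div K)"
        "length (ancestor ys (Suc (e' div K))) = Suc (e' div K)"
      by (simp_all add: length_ancestor)
    \<comment> \<open>The ends of an edge differ in length by one, which excludes matching the pairs
      crosswise.\<close>
    then have "ancestor xs (e div K) = ancestor ys (e' div K) \<and> e mod K = e' mod K \<and>
        ancestor xs (Suc (e div K)) = ancestor ys (Suc (e' div K))"
      using 2(3) len by (auto simp: doubleton_eq_iff)
    moreover from this have "e div K = e' div K" using len by metis
    ultimately show ?thesis using l 2(1) by (metis div_mult_mod_eq)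
  qed
  show "e = e'" using * by (rule conjunct1)
  show "ancestor xs (e div K) = ancestor ys (e div K)" if "e mod K = 0"
    using * that by metis
  show "e div K < length xs \<and> e div K < length ys \<and>
      ancestor xs (Suc (e div K)) = ancestor ys (Suc (e div K))" if "e mod K \<noteq> 0"
    using * that by metis
qed

lemma spot_eq_above:
  assumes "e \<le> K * length xs" "e \<le> K * length ys" "spot xs e = spot ys e" "f \<le> e"
  shows "spot xs f = spot ys f"
proof (cases "e mod K = 0")
  case True
  have "e div K \<le> length xs" "e div K \<le> length ys"
    using assms(1,2) div_le_mono[of e "K * length xs" K] div_le_mono[of e "K * length ys" K]
    by simp_all
  moreover have "f \<le> K * (e div K)" using True assms(4) by auto
  ultimately show ?thesis using spot_cong spot_eqD(2)[OF assms(1-3) True] by blast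
next
  case False
  have "f \<le> K * Suc (e div K)" using assms(4) dividend_less_times_div[of K e] K_pos by simp
  then show ?thesis using spot_cong[of xs "Suc (e div K)" ys] spot_eqD(3)[OF assms(1-3) False] by auto
qed

section \<open>The shape of paths\<close>

definition up_edge :: "nat list subdiv \<Rightarrow> nat list subdiv \<Rightarrow> bool" where
  "up_edge v w \<longleftrightarrow> (\<exists>xs e. node xs \<and> e < K * length xs \<and> v = spot xs (Suc e) \<and> w = spot xs e)"

lemma up_edge_spot:
  assumes "up_edge (spot xs e) w" "e \<le> K * length xs"
  shows "e > 0 \<and> w = spot xs (e - 1)"
proof -
  obtain ys f where *: "f < K * length ys" "spot xs e = spot ys (Suc f)" "w = spot ys f"
    using assms(1) unfolding up_edge_def by blast
  then have "e = Suc f" using spot_eqD(1)[OF assms(2) _ *(2)] by simp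
  then show ?thesis using spot_eq_above[of e xs ys f] * assms(2) by simp
qed

lemma up_edge_unique: "up_edge v w \<Longrightarrow> up_edge v w' \<Longrightarrow> w = w'"
  using up_edge_spot unfolding up_edge_def by (metis Suc_leI)

lemma up_chain:
  assumes "\<And>i. i < t \<Longrightarrow> up_edge (q i) (q (Suc i))" "q 0 = spot xs e" "e \<le> K * length xs"
  shows "i \<le> t \<Longrightarrow> i \<le> e \<and> q i = spot xs (e - i)"
proof (induction i)
  case (Suc i)
  then have "up_edge (spot xs (e - i)) (q (Suc i))" "i \<le> e" using assms(1)[of i] by auto
  moreover have "e - i \<le> K * length xs" using assms(3) by simp
  ultimately show ?case using up_edge_spot[of xs "e - i" "q (Suc i)"] by simp
qed (use assms in simp)

lemma edge_up_edge:
  assumes "{v, w} \<in> edges S"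
  shows "up_edge v w \<or> up_edge w v"
  using assms unfolding up_edge_def by (elim edgeE) (auto simp: doubleton_eq_iff)

text \<open>A vertex has only one neighbour above it, so a path that has stepped down cannot step up
  again without repeating a vertex.\<close>

lemma path_turn:
  assumes p: "is_path S p"
  obtains t where "t < length p"
    "\<And>i. i < t \<Longrightarrow> up_edge (p ! i) (p ! Suc i)"
    "\<And>i. t \<le> i \<Longrightarrow> Suc i < length p \<Longrightarrow> up_edge (p ! Suc i) (p ! i)"
proof -
  define t where "t = (LEAST i. length p \<le> Suc i \<or> up_edge (p ! Suc i) (p ! i))"
  have ne: "p \<noteq> []" and dist: "distinct p"
    and adj: "\<And>i. Suc i < length p \<Longrightarrow> {p ! i, p ! Suc i} \<in> edges S"
    using p unfolding is_path_def by auto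
  have t: "length p \<le> Suc t \<or> up_edge (p ! Suc t) (p ! t)"
    unfolding t_def by (rule LeastI[of _ "length p"]) simp
  have "t \<le> length p - 1" unfolding t_def by (rule Least_le, rule disjI1, arith)
  then have "t < length p" using ne by (cases p) auto
  moreover have "up_edge (p ! i) (p ! Suc i)" if "i < t" for i
  proof -
    have "\<not> (length p \<le> Suc i \<or> up_edge (p ! Suc i) (p ! i))"
      using that unfolding t_def by (rule not_less_Least)
    then show ?thesis using adj[of i] edge_up_edge by auto
  qed
  moreover have "up_edge (p ! Suc i) (p ! i)" if "t \<le> i" "Suc i < length p" for i
    using that
  proof (induction i rule: dec_induct)
    case base
    then show ?case using t by simp
  next
    case (step i)
    then have "up_edge (p ! Suc i) (p ! i)" by simp
    moreover have "p ! i \<noteq> p ! Suc (Suc i)" using dist step by (simp add: nth_eq_iff_index_eq)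
    ultimately show ?case using edge_up_edge[OF adj[of "Suc i"]] up_edge_unique step by blast
  qed
  ultimately show thesis by (rule that)
qed

text \<open>The topmost vertex, at depth \<open>E\<close>, is listed once, with the side of
  \<open>ys\<close>.\<close>

definition bent_path :: "nat list \<Rightarrow> nat list \<Rightarrow> nat \<Rightarrow> nat \<Rightarrow> nat \<Rightarrow> nat list subdiv list" where
  "bent_path xs ys E El Er = map (spot xs) (rev [Suc E..<Suc El]) @ map (spot ys) [E..<Suc Er]"

text \<open>From either end, \<open>up_chain\<close> follows spots up to the turn, where the two
  depths agree. If both sides are non-empty, distinctness of the path separates their first
  vertices.\<close>

lemma path_bent:
  assumes p: "is_path S p"
  obtains xs ys E El Er where "node xs" "node ys" "E \<le> El" "E \<le> Er"
    "El \<le> K * length xs" "Er \<le> K * length ys" "spot xs E = spot ys E"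
    "El = E \<or> Er = E \<or> spot xs (Suc E) \<noteq> spot ys (Suc E)" "p = bent_path xs ys E El Er"
proof -
  obtain t where t: "t < length p"
    "\<And>i. i < t \<Longrightarrow> up_edge (p ! i) (p ! Suc i)"
    "\<And>i. t \<le> i \<Longrightarrow> Suc i < length p \<Longrightarrow> up_edge (p ! Suc i) (p ! i)"
    using path_turn[OF p] by blast
  define n where "n = length p - 1"
  have n: "length p = Suc n" "t \<le> n" using t(1) by (auto simp: n_def)
  have in_verts: "p ! i \<in> verts S" if "i \<le> n" for i
    using p that n(1) unfolding is_path_def by (metis le_imp_less_Suc nth_mem subsetD)
  obtain xs El where xs: "node xs" "El \<le> K * length xs" "p ! 0 = spot xs El"
    using vertexE[OF in_verts[of 0]] by blast
  obtain ys Er where ys: "node ys" "Er \<le> K * length ys" "p ! n = spot ys Er"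
    using vertexE[OF in_verts[of n]] by blast
  have left: "i \<le> El \<and> p ! i = spot xs (El - i)" if "i \<le> t" for i
    by (rule up_chain[of t "(!) p"]) (use t(2) xs that in auto)
  have right: "i \<le> Er \<and> p ! (n - i) = spot ys (Er - i)" if "i \<le> n - t" for i
  proof (rule up_chain[of "n - t" "\<lambda>i. p ! (n - i)"])
    fix i assume "i < n - t"
    then show "up_edge (p ! (n - i)) (p ! (n - Suc i))"
      using t(3)[of "n - Suc i"] n by (simp add: Suc_diff_Suc)
  qed (use ys that in auto)
  define E where "E = El - t"
  have le: "t \<le> El" "n - t \<le> Er" using left right by auto
  have "spot xs (El - t) = spot ys (Er - (n - t))"
    using left[of t] right[of "n - t"] n(2) by simp
  moreover from this have "El - t = Er - (n - t)"
    by (rule spot_eqD(1)[rotated -1]) (use xs(2) ys(2) in auto)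
  ultimately have E: "E = Er - (n - t)" "spot xs E = spot ys E" unfolding E_def by simp_all
  show thesis
  proof (rule that[OF xs(1) ys(1) _ _ xs(2) ys(2) E(2)])
    show "E \<le> El" "E \<le> Er" using E E_def by auto
    show "El = E \<or> Er = E \<or> spot xs (Suc E) \<noteq> spot ys (Suc E)"
    proof (cases "t = 0 \<or> t = n")
      case True
      then show ?thesis using E E_def by auto
    next
      case False
      then have "p ! (t - 1) = spot xs (Suc E)" "p ! (t + 1) = spot ys (Suc E)"
        using left[of "t - 1"] right[of "n - t - 1"] le n(2) E E_def
        by (auto simp: Suc_diff_le intro: arg_cong2[of _ _ _ _ spot])
      moreover have "p ! (t - 1) \<noteq> p ! (t + 1)"
        using p False n unfolding is_path_def by (subst nth_eq_iff_index_eq) auto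
      ultimately show ?thesis by simp
    qed
    show "p = bent_path xs ys E El Er"
    proof (rule nth_equalityI)
      show "length p = length (bent_path xs ys E El Er)"
        using n le E E_def unfolding bent_path_def by auto
      fix i assume i: "i < length p"
      show "p ! i = bent_path xs ys E El Er ! i"
      proof (cases "i < t")
        case True
        then have "rev [Suc E..<Suc El] ! i = El - i"
          using le E_def by (simp add: rev_nth del: upt_Suc) 
        then show ?thesis using left[of i] True le E_def unfolding bent_path_def by (simp add: nth_append del: upt_Suc)
      next
        case False
        then have "p ! i = spot ys (Er - (n - i))" using right[of "n - i"] i n by auto
        also have "Er - (n - i) = E + (i - t)" using False i n le E(1) by linarith
        also have "E + (i - t) = [E..<Suc Er] ! (i - t)"
          using False i n le E(1) by (intro nth_upt[symmetric]) linarith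
        also have "spot ys ([E..<Suc Er] ! (i - t)) = map (spot ys) [E..<Suc Er] ! (i - t)"
          using False i n le E(1) by (intro nth_map[symmetric]) (simp del: upt_Suc)
        also have "length (map (spot xs) (rev [Suc E..<Suc El])) = t"
          using le E_def by (simp del: upt_Suc)
        then have "map (spot ys) [E..<Suc Er] ! (i - t) = bent_path xs ys E El Er ! i"
          using False unfolding bent_path_def by (simp only: nth_append if_False)
        finally show ?thesis .
      qed
    qed
  qed
qed

text \<open>A vertex common to both sides would have the same depth on both and make the chains
  above it agree, also at depth \<open>Suc E\<close>.\<close>

lemma bent_path_is_path:
  assumes "node xs" "node ys" "E \<le> El" "E \<le> Er" "El \<le> K * length xs" "Er \<le> K * length ys"
    and "spot xs E = spot ys E" and branch: "spot xs (Suc E) \<noteq> spot ys (Suc E)"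
  shows "is_path S (bent_path xs ys E El Er)"
  unfolding is_path_def
proof (intro conjI allI impI)
  let ?p = "bent_path xs ys E El Er"
  show "?p \<noteq> []" using assms(4) unfolding bent_path_def by simp
  have inj: "inj_on (spot zs) {..K * length zs}" for zs
    using spot_eqD(1) by (auto simp: inj_on_def)
  have "spot xs ` {Suc E..<Suc El} \<inter> spot ys ` {E..<Suc Er} = {}"
  proof (intro equals0I, elim IntE imageE)
    fix v e f assume *: "e \<in> {Suc E..<Suc El}" "f \<in> {E..<Suc Er}" "v = spot xs e" "v = spot ys f"
    then have "e = f" using spot_eqD(1)[of e xs f ys] assms(5,6) by auto
    then show False using spot_eq_above[of e xs ys "Suc E"] * assms(5,6) branch by auto
  qed
  moreover have "inj_on (spot xs) {Suc E..<Suc El}" "inj_on (spot ys) {E..<Suc Er}"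
    by (rule inj_on_subset[OF inj]; use assms(5,6) in auto)+
  ultimately show "distinct ?p"
    unfolding bent_path_def by (auto simp: distinct_map simp del: upt_Suc)
  show "set ?p \<subseteq> verts S"
    using assms(1-6) unfolding bent_path_def by (auto intro!: spot_vertex simp del: upt_Suc)
  fix i assume i: "Suc i < length ?p"
  have left: "?p ! j = spot xs (El - j)" if "j \<le> El - E" for j
  proof (cases "j < El - E")
    case True
    then have "rev [Suc E..<Suc El] ! j = El - j" by (simp add: rev_nth del: upt_Suc)
    then show ?thesis using True unfolding bent_path_def by (simp add: nth_append del: upt_Suc)
  next
    case False
    then have "j = El - E" using that by simp
    moreover have "[E..<Suc Er] ! 0 = E" using assms(4) by (subst nth_upt) auto
    ultimately show ?thesis
      using assms(3,4,7) unfolding bent_path_def by (simp add: nth_append del: upt_Suc)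
  qed
  have right: "?p ! j = spot ys (E + (j - (El - E)))" if "El - E \<le> j" "j < length ?p" for j
  proof -
    have "j - (El - E) < Suc Er - E" using that unfolding bent_path_def by (auto simp del: upt_Suc)
    moreover from this have "[E..<Suc Er] ! (j - (El - E)) = E + (j - (El - E))" by (intro nth_upt) simp
    ultimately show ?thesis using that unfolding bent_path_def by (simp add: nth_append del: upt_Suc)
  qed
  show "{?p ! i, ?p ! Suc i} \<in> edges S"
  proof (cases "i < El - E")
    case True
    then show ?thesis
      using left[of i] left[of "Suc i"] spot_edge[OF assms(1), of "El - Suc i"] assms(5)
      by (simp add: Suc_diff_Suc insert_commute)
  next
    case False
    then have "Suc (E + (i - (El - E))) \<le> Er" using i assms(4) unfolding bent_path_def by (auto simp del: upt_Suc)
    then show ?thesis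
      using right[of i] right[of "Suc i"] i False spot_edge[OF assms(2), of "E + (i - (El - E))"] assms(6)
      by (simp add: Suc_diff_le)
  qed
qed

lemma rev_bent_path:
  assumes "E \<le> El" "E \<le> Er" "spot xs E = spot ys E"
  shows "rev (bent_path xs ys E El Er) = bent_path ys xs E Er El"
proof -
  have "[E..<Suc Er] = E # [Suc E..<Suc Er]" "[E..<Suc El] = E # [Suc E..<Suc El]"
    using assms by (simp_all add: upt_conv_Cons)
  then show ?thesis unfolding bent_path_def using assms(3) by (simp add: rev_map del: upt_Suc)
qed

end

section \<open>Lower bound\<close>

text \<open>The size makes one count redundant, which saves a factor in the count of leaves.\<close>

lemma mset_eq_if_counts_except:
  assumes "size M = size N" "\<And>j. j \<noteq> i \<Longrightarrow> count M j = count N j"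
  shows "M = N"
proof -
  have "filter_mset (\<lambda>j. j \<noteq> i) M = filter_mset (\<lambda>j. j \<noteq> i) N"
    using assms(2) by (intro multiset_eqI) simp
  moreover have "X = filter_mset (\<lambda>j. j \<noteq> i) X + replicate_mset (count X i) i" for X :: "'a multiset"
    by (rule multiset_eqI) simp
  ultimately have "count M i = count N i"
    using assms(1) by (metis add_left_cancel size_replicate_mset size_union)
  then show ?thesis using assms(2) by (metis multiset_eqI)
qed

context subdivided_tree
begin

section \<open>Monochromatic embedded trees\<close>

text \<open>A topologically embedded complete \<open>d\<close>-ary tree of height \<open>m\<close>
  with leaf set \<open>L\<close>, whose leaves and branching vertices have colour \<open>i\<close>.
  Its root \<open>zs @ x\<close> may be any descendant of \<open>x\<close>, so vertices of other
  colours are passed over.\<close>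

inductive mono_tree :: "(nat list \<Rightarrow> nat) \<Rightarrow> nat \<Rightarrow> nat \<Rightarrow> nat list \<Rightarrow> nat list set \<Rightarrow> bool"
  for f i where
  leaf: "node (zs @ x) \<Longrightarrow> f (zs @ x) = i \<Longrightarrow> mono_tree f i 0 x {zs @ x}"
| branch: "node (zs @ x) \<Longrightarrow> f (zs @ x) = i \<Longrightarrow> (\<And>s. s < d \<Longrightarrow> mono_tree f i m (s # zs @ x) (L s)) \<Longrightarrow>
    mono_tree f i (Suc m) x (\<Union>s<d. L s)"

lemma mono_tree_lift:
  assumes "mono_tree f i m (s # x) L"
  shows "mono_tree f i m x L"
  using assms
proof cases
  case (leaf zs)
  then show ?thesis using mono_tree.leaf[of "zs @ [s]" x f i] by simp
next
  case (branch zs m' L')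
  then show ?thesis using mono_tree.branch[of "zs @ [s]" x f i m' L'] by simp
qed

lemma mono_tree_truncate:
  "mono_tree f i m x L \<Longrightarrow> m' \<le> m \<Longrightarrow> \<exists>L'. mono_tree f i m' x L'"
proof (induction arbitrary: m' rule: mono_tree.induct)
  case (leaf zs x)
  then show ?case using mono_tree.leaf by fastforce
next
  case (branch zs x m L)
  show ?case
  proof (cases m')
    case 0
    then show ?thesis using mono_tree.leaf branch(1,2) by blast
  next
    case (Suc n)
    then have "\<forall>s. \<exists>L'. s < d \<longrightarrow> mono_tree f i n (s # zs @ x) L'" using branch(4)[of _ n] branch.prems by auto
    then obtain L' where "\<And>s. s < d \<Longrightarrow> mono_tree f i n (s # zs @ x) (L' s)" by metis
    then show ?thesis using mono_tree.branch branch(1,2) Suc by blast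
  qed
qed

lemma mono_tree_leaf:
  "mono_tree f i m x L \<Longrightarrow> a \<in> L \<Longrightarrow> node a \<and> f a = i \<and> (\<exists>zs. a = zs @ x)"
proof (induction rule: mono_tree.induct)
  case (branch zs x m L)
  then obtain s where "s < d" "a \<in> L s" by blast
  then obtain zs' where "node a" "f a = i" "a = (zs' @ s # zs) @ x" using branch(4) by force
  then show ?case by blast
qed auto

lemma mono_tree_card:
  "mono_tree f i m x L \<Longrightarrow> finite L \<and> card L = d ^ m"
proof (induction rule: mono_tree.induct)
  case (branch zs x m L)
  have "L s \<inter> L t = {}" if st: "s < d" "t < d" "s \<noteq> t" for s t
  proof (rule equals0I)
    fix a assume "a \<in> L s \<inter> L t"
    then obtain as bs where "a = as @ s # zs @ x" "a = bs @ t # zs @ x"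
      using mono_tree_leaf[OF branch(3)[OF st(1)]] mono_tree_leaf[OF branch(3)[OF st(2)]] by blast
    then have "(as @ [s]) @ zs @ x = (bs @ [t]) @ zs @ x" by simp
    then show False using st(3) by (simp only: append_same_eq append1_eq_conv simp_thms)
  qed
  then have "card (\<Union>s<d. L s) = (\<Sum>s<d. card (L s))" using branch(4) by (intro card_UN_disjoint) auto
  then show ?case using branch(4) by simp
qed simp

lemma mono_tree_fork:
  "mono_tree f i m x L \<Longrightarrow> a \<in> L \<Longrightarrow> b \<in> L \<Longrightarrow> a \<noteq> b \<Longrightarrow>
    \<exists>y s t as bs. s \<noteq> t \<and> a = as @ s # y \<and> b = bs @ t # y \<and> f y = i"
proof (induction rule: mono_tree.induct)
  case (branch zs x m L)
  then obtain s t where st: "s < d" "a \<in> L s" "t < d" "b \<in> L t" by blast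
  show ?case
  proof (cases "s = t")
    case True
    then show ?thesis using branch(4)[OF st(1)] st branch.prems(3) by blast
  next
    case False
    obtain as bs where "a = as @ s # zs @ x" "b = bs @ t # zs @ x"
      using mono_tree_leaf[OF branch(3)[OF st(1)] st(2)] mono_tree_leaf[OF branch(3)[OF st(3)] st(4)] by blast
    then show ?thesis using False branch(2) by blast
  qed
qed simp

text \<open>Here \<open>F i\<close> counts the vertex levels of a largest tree of colour \<open>i\<close>. At a vertex of
  colour \<open>j\<close>, the child whose value for \<open>j\<close> is least determines all values.\<close>

lemma mono_tree_levels:
  assumes "d > 0" and f: "\<And>x. node x \<Longrightarrow> f x < c"
  shows "node x \<Longrightarrow> length x + r = h \<Longrightarrow>
    \<exists>F. r < (\<Sum>i<c. F i) \<and> (\<forall>i<c. F i > 0 \<longrightarrow> (\<exists>L. mono_tree f i (F i - 1) x L))"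
proof (induction r arbitrary: x)
  case 0
  have "mono_tree f (f x) 0 x {x}" using mono_tree.leaf[of "[]" x f "f x"] 0 by simp
  moreover have "(\<Sum>i<c. if i = f x then 1 else 0) = (1 :: nat)" using f[OF 0(1)] by simp
  ultimately show ?case by (intro exI[of _ "\<lambda>i. if i = f x then 1 else 0"]) auto
next
  case (Suc r)
  have child: "node (s # x)" if "s < d" for s using Suc.prems that unfolding node_def by auto
  have "\<forall>s. \<exists>F. s < d \<longrightarrow> r < (\<Sum>i<c. F i) \<and>
      (\<forall>i<c. F i > 0 \<longrightarrow> (\<exists>L. mono_tree f i (F i - 1) (s # x) L))"
    using Suc.IH[OF child] Suc.prems(2) by auto
  then obtain F where F: "\<And>s. s < d \<Longrightarrow> r < (\<Sum>i<c. F s i)"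
      "\<And>s i. s < d \<Longrightarrow> i < c \<Longrightarrow> F s i > 0 \<Longrightarrow> \<exists>L. mono_tree f i (F s i - 1) (s # x) L"
    by metis
  define j where "j = f x"
  have j: "j < c" unfolding j_def by (rule f) (rule Suc.prems)
  obtain s where s: "s < d" "\<And>t. t < d \<Longrightarrow> F s j \<le> F t j"
    using ex_min_if_finite[of "(\<lambda>t. F t j) ` {..<d}"] assms(1) by (force simp: not_less)
  define G where "G = (F s)(j := Suc (F s j))"
  have "(\<Sum>i<c. G i) = Suc (\<Sum>i<c. F s i)"
    using j sum.remove[of "{..<c}" j G] sum.remove[of "{..<c}" j "F s"] by (simp add: G_def)
  then have "Suc r < (\<Sum>i<c. G i)" using F(1)[OF s(1)] by simp
  moreover have "\<exists>L. mono_tree f i (G i - 1) x L" if i: "i < c" "G i > 0" for i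
  proof (cases "i = j")
    case False
    then show ?thesis using F(2)[OF s(1) i(1)] i(2) mono_tree_lift by (fastforce simp: G_def)
  next
    case True
    show ?thesis
    proof (cases "F s j")
      case 0
      have "mono_tree f j 0 x {x}" using mono_tree.leaf[of "[]" x f j] Suc.prems j_def by simp
      then show ?thesis using True 0 by (auto simp: G_def)
    next
      case (Suc m)
      have "\<exists>L. mono_tree f j m (t # x) L" if "t < d" for t
        using F(2)[OF that j] s(2)[OF that] Suc mono_tree_truncate[of f j "F t j - 1" "t # x" _ m] by fastforce
      then obtain L where "\<And>t. t < d \<Longrightarrow> mono_tree f j m (t # x) (L t)" by metis
      then have "mono_tree f j (Suc m) x (\<Union>t<d. L t)"
        using mono_tree.branch[of "[]" x f j m L] Suc.prems j_def by simp
      then show ?thesis using True Suc by (auto simp: G_def)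
    qed
  qed
  ultimately show ?case by blast
qed

section \<open>From equal colour counts to the lower bound\<close>

text \<open>Without its end \<open>b\<close>, the path from \<open>a\<close> to \<open>b\<close>
  splits into the side of \<open>a\<close> below the fork, and the fork with the other side. Both
  \<open>a\<close> and the fork have colour \<open>i\<close>; above the fork the root paths coincide
  and cancel.\<close>

lemma mono_tree_inj:
  assumes free: "anagram_free_colouring S \<phi>"
    and L: "mono_tree (\<lambda>x. \<phi> (Orig x)) i m [] L"
    and ab: "a \<in> L" "b \<in> L" "length a = length b"
    and counts: "\<And>j. j \<noteq> i \<Longrightarrow> count (mset (map (\<lambda>e. \<phi> (spot a e)) [1..<K * length a])) j
      = count (mset (map (\<lambda>e. \<phi> (spot b e)) [1..<K * length b])) j"
  shows "a = b"
proof (rule ccontr)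
  assume "a \<noteq> b"
  then obtain y s t as bs where st: "s \<noteq> t" "a = as @ s # y" "b = bs @ t # y" "\<phi> (Orig y) = i"
    using mono_tree_fork[OF L ab(1,2)] by blast
  define E where "E = K * length y"
  define T where "T = K * length a"
  have node: "node a" "node b" "\<phi> (Orig a) = i" using mono_tree_leaf[OF L] ab by auto
  have anc: "ancestor a (length y) = y" "ancestor b (length y) = y"
      "ancestor a (length (s # y)) = s # y" "ancestor b (length (t # y)) = t # y"
    using ancestor_append[of "as @ [s]" y] ancestor_append[of "bs @ [t]" y]
      ancestor_append[of as "s # y"] ancestor_append[of bs "t # y"] st(2,3) by simp_all
  have "K * length y + K \<le> T" unfolding T_def st(2) by simp
  then have T: "Suc E \<le> T" "T = K * length b" "Suc (T - 1) = T"
    unfolding E_def T_def ab(3) using K_pos by linarith+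
  have spotE: "spot a E = Orig y" "spot b E = Orig y" "spot a T = Orig a"
    unfolding E_def T_def using anc by (simp_all add: spot_original)
  have ne: "spot a (Suc E) \<noteq> spot b (Suc E)"
  proof
    assume eq: "spot a (Suc E) = spot b (Suc E)"
    have le: "Suc E \<le> K * length a" "Suc E \<le> K * length b" using T T_def by auto
    have "ancestor a (length (s # y)) = ancestor b (length (s # y))"
    \<comment> \<open>The vertex below the fork is an original one exactly if
      \<open>K = 1\<close>.\<close>
    proof (cases "Suc E mod K = 0")
      case True
      then have "K dvd K * length y + 1" unfolding E_def by (simp add: dvd_eq_mod_eq_0)
      then have "K dvd 1" by (simp only: dvd_add_right_iff[OF dvd_triv_left])
      then have "K = 1" by simp
      then show ?thesis using spot_eqD(2)[OF le eq True] unfolding E_def by simp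
    next
      case False
      then have "K \<noteq> 1" by auto
      then have "1 < K" using K_pos by linarith
      then have "(K * length y + 1) div K = length y" by (simp del: One_nat_def)
      then have "Suc E div K = length y" unfolding E_def by simp
      then show ?thesis using spot_eqD(3)[OF le eq False] by simp
    qed
    then show False using anc st(1) by simp
  qed
  have p: "is_path S (bent_path a b E T (T - 1))"
    by (rule bent_path_is_path) (use node T T_def spotE ne in auto)
  define A B where "A = map (\<lambda>e. \<phi> (spot a e)) [Suc E..<T]" and "B = map (\<lambda>e. \<phi> (spot b e)) [Suc E..<T]"
  have split: "[1..<T] = [1..<Suc E] @ [Suc E..<T]"
    using T(1) upt_add_eq_append[of 1 "Suc E" "T - Suc E"] by (simp del: upt_Suc)
  have common: "map (\<lambda>e. \<phi> (spot a e)) [1..<Suc E] = map (\<lambda>e. \<phi> (spot b e)) [1..<Suc E]"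
    using spot_eq_above[of E a b] spotE T T_def by (auto simp del: upt_Suc)
  have "mset (map (\<lambda>e. \<phi> (spot a e)) [1..<T]) = mset (map (\<lambda>e. \<phi> (spot b e)) [1..<T])"
  proof (rule mset_eq_if_counts_except[of _ _ i])
    fix j assume "j \<noteq> i"
    then show "count (mset (map (\<lambda>e. \<phi> (spot a e)) [1..<T])) j = count (mset (map (\<lambda>e. \<phi> (spot b e)) [1..<T])) j"
      using counts[of j] T(2) T_def by simp
  qed simp
  then have AB: "mset A = mset B"
    unfolding split map_append mset_append common A_def B_def by (rule add_left_imp_eq)
  define W P where "W = map (\<lambda>e. \<phi> (spot a e)) (rev [Suc E..<Suc T])" and "P = map (\<lambda>e. \<phi> (spot b e)) [E..<T]"
  have "[Suc E..<Suc T] = [Suc E..<T] @ [T]" using T(1) by simp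
  then have W: "mset W = add_mset i (mset A)" unfolding W_def A_def using spotE node by (simp del: upt_Suc)
  have "[E..<T] = E # [Suc E..<T]" using T(1) by (simp add: upt_conv_Cons)
  then have P: "mset P = add_mset i (mset B)" unfolding P_def B_def using spotE st by (simp del: upt_Suc)
  have "map \<phi> (bent_path a b E T (T - 1)) = W @ P"
    unfolding bent_path_def W_def P_def T(3) by (simp add: o_def del: upt_Suc)
  moreover have "W \<noteq> []" using W by auto
  ultimately have "anagram (map \<phi> (bent_path a b E T (T - 1)))"
    unfolding anagram_def using W P AB by metis
  then show False using free p unfolding anagram_free_colouring_def by blast
qed

text \<open>Some colour \<open>i\<close> has a tree with \<open>F i > h / c\<close> levels. Its
  leaves differ in depth or in one of \<open>c - 1\<close> colour counts, so
  \<open>d ^ (F i - 1) \<le> h * n ^ (c - 1)\<close>. Multiplying by \<open>d\<close> and using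
  \<open>d * h \<le> n\<close> gives \<open>d ^ F i \<le> n ^ c\<close>; then the
  \<open>c\<close>-th power is taken.\<close>

theorem colours_lower_bound:
  assumes "d \<ge> 2" "h \<ge> 1" "d \<le> k"
    and \<phi>: "\<phi> ` verts S \<subseteq> {..<c}" "anagram_free_colouring S \<phi>"
  shows "d ^ h \<le> (h * K) ^ (c * c)"
proof -
  define n where "n = h * K"
  define f where "f x = \<phi> (Orig x)" for x
  have f: "f x < c" if "node x" for x
  proof -
    have "Orig x \<in> verts S" using that unfolding subdivision_def fst_conv verts_tree by blast
    then show ?thesis using \<phi>(1) unfolding f_def by blast
  qed
  have "node []" by (simp add: node_def)
  then have "c > 0" using f by fastforce
  obtain F where F: "h < (\<Sum>i<c. F i)" "\<And>i. i < c \<Longrightarrow> F i > 0 \<Longrightarrow> \<exists>L. mono_tree f i (F i - 1) [] L"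
    using mono_tree_levels[of f c "[]" h] f \<open>node []\<close> assms(1) by auto
  have "\<exists>i<c. h < c * F i"
  proof (rule ccontr)
    assume "\<not> ?thesis"
    then have "c * F i \<le> h" if "i < c" for i using that by (meson not_less)
    then have "(\<Sum>i<c. c * F i) \<le> (\<Sum>i<c. h)" by (intro sum_mono) simp
    then have "c * (\<Sum>i<c. F i) \<le> c * h" by (simp add: sum_distrib_left)
    then show False using F(1) \<open>c > 0\<close> by simp
  qed
  then obtain i where i: "i < c" "h < c * F i" by blast
  then have "F i > 0" by (cases "F i") auto
  then obtain L where L: "mono_tree f i (F i - 1) [] L" using F(2) i by blast
  have L': "mono_tree (\<lambda>x. \<phi> (Orig x)) i (F i - 1) [] L" using L unfolding f_def .
  have Lcard: "finite L" "card L = d ^ (F i - 1)" using mono_tree_card[OF L] by auto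
  have n: "d * h \<le> n" "n > 0"
    using assms(2,3) K_eq mult_le_mono1[of d K h] unfolding n_def by (simp_all add: mult.commute)
  have "card L \<le> h * n ^ (c - 1)"
  proof (cases "F i = 1")
    case True
    then show ?thesis using Lcard assms(2) n by simp
  next
    case False
    then have "F i - 1 > 0" using \<open>F i > 0\<close> by simp
    then have "card L \<ge> 2" using assms(1) unfolding Lcard(2) using self_le_power[of d "F i - 1"] by simp
    \<comment> \<open>Every leaf is strictly below a fork, hence not the root, which leaves
      \<open>h\<close> rather than \<open>h + 1\<close> depths.\<close>
    have nonempty: "a \<noteq> []" if "a \<in> L" for a
    proof -
      have "\<exists>b \<in> L. b \<noteq> a" using \<open>card L \<ge> 2\<close> Lcard(1)
        by (metis card_le_Suc0_iff_eq not_less_eq_eq numeral_2_eq_2)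
      then show ?thesis using mono_tree_fork[OF L that] by blast
    qed
    define C where "C a = mset (map (\<lambda>e. \<phi> (spot a e)) [1..<K * length a])" for a
    define \<Phi> where "\<Phi> a = (length a, restrict (count (C a)) ({..<c} - {i}))" for a
    have "inj_on \<Phi> L"
    proof (rule inj_onI)
      fix a b assume ab: "a \<in> L" "b \<in> L" "\<Phi> a = \<Phi> b"
      have out: "count (C a) j = 0" if "a \<in> L" "j \<ge> c" for a j
      proof -
        have "node a" using mono_tree_leaf[OF L that(1)] by blast
        then have "\<phi> (spot a e) < c" if "e \<in> {1..<K * length a}" for e
          using that \<phi>(1) spot_vertex[of a e] by auto
        then have "j \<notin> (\<lambda>e. \<phi> (spot a e)) ` {1..<K * length a}" using that(2) by fastforce
        then show ?thesis unfolding C_def by (simp add: count_eq_zero_iff)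
      qed
      show "a = b"
      proof (rule mono_tree_inj[OF \<phi>(2) L' ab(1,2)])
        show "length a = length b" using ab(3) unfolding \<Phi>_def by simp
        fix j assume "j \<noteq> i"
        have "restrict (count (C a)) ({..<c} - {i}) j = restrict (count (C b)) ({..<c} - {i}) j"
          using ab(3) unfolding \<Phi>_def by simp
        then have "count (C a) j = count (C b) j"
          using out[OF ab(1), of j] out[OF ab(2), of j] \<open>j \<noteq> i\<close> by (cases "j < c") auto
        then show "count (mset (map (\<lambda>e. \<phi> (spot a e)) [1..<K * length a])) j
            = count (mset (map (\<lambda>e. \<phi> (spot b e)) [1..<K * length b])) j" unfolding C_def .
      qed
    qed
    moreover have "\<Phi> ` L \<subseteq> {1..h} \<times> ({..<c} - {i} \<rightarrow>\<^sub>E {..<n})"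
    proof (rule image_subsetI)
      fix a assume a: "a \<in> L"
      then have len: "length a \<ge> 1" "length a \<le> h"
        using nonempty[OF a] mono_tree_leaf[OF L a] unfolding node_def by (cases a; simp)+
      have "count (C a) j < n" for j
      proof -
        have "count (C a) j \<le> size (C a)" by (rule count_le_size)
        also have "\<dots> < K * length a" unfolding C_def using len K_pos by (cases a) auto
        also have "\<dots> \<le> n" unfolding n_def using len by (simp add: mult.commute)
        finally show ?thesis .
      qed
      then show "\<Phi> a \<in> {1..h} \<times> ({..<c} - {i} \<rightarrow>\<^sub>E {..<n})" unfolding \<Phi>_def using len by auto
    qed
    moreover have "finite ({1..h} \<times> ({..<c} - {i} \<rightarrow>\<^sub>E {..<n}))" by (intro finite_cartesian_product finite_PiE) simp_all
    moreover have "card ({1..h} \<times> ({..<c} - {i} \<rightarrow>\<^sub>E {..<n})) = h * n ^ (c - 1)"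
      using i by (simp add: card_cartesian_product card_PiE)
    ultimately show ?thesis by (metis card_inj_on_le)
  qed
  then have "d * d ^ (F i - 1) \<le> d * (h * n ^ (c - 1))" unfolding Lcard by simp
  also have "\<dots> \<le> n * n ^ (c - 1)" using mult_le_mono1[OF n(1), of "n ^ (c - 1)"] by (simp add: mult.assoc)
  finally have "d ^ F i \<le> n ^ c" using \<open>F i > 0\<close> \<open>c > 0\<close> by (simp flip: power_Suc)
  then have "(d ^ F i) ^ c \<le> (n ^ c) ^ c" by (rule power_mono) simp
  moreover have "d ^ h \<le> d ^ (c * F i)" using i(2) assms(1) by (intro power_increasing) auto
  ultimately show ?thesis unfolding n_def[symmetric] by (simp add: power_mult[symmetric] mult.commute)
qed

end

section \<open>Upper bound\<close>

lemma filler_letters: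
  "\<exists>u :: nat \<Rightarrow> nat. (\<forall>i. u i < 8) \<and>
    (\<forall>i j l. i < j \<longrightarrow> j \<le> l \<longrightarrow> l \<le> n \<longrightarrow> mset (map u [i..<j]) \<noteq> mset (map u [j..<l]))"
proof -
  obtain w :: "nat list" where w: "length w = n" "set w \<subseteq> {..<8}" "avoids_anagrams w"
    using avoids_anagrams_eight_letters by blast
  \<comment> \<open>The value 0 beyond the word only keeps \<open>u i < 8\<close> true.\<close>
  define u where "u i = (if i < n then w ! i else 0)" for i
  have w_eq: "w = map u [0..<n]" by (rule nth_equalityI) (use w(1) in \<open>auto simp: u_def\<close>)
  show ?thesis
  proof (intro exI[of _ u] conjI allI impI)
    show "u i < 8" for i using w(1,2) nth_mem[of i w] unfolding u_def by fastforce
    fix i j l assume *: "i < j" "j \<le> l" "l \<le> n"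
    have "[0..<n] = [0..<i] @ [i..<n]" "[i..<n] = [i..<j] @ [j..<n]" "[j..<n] = [j..<l] @ [l..<n]"
      using * upt_add_eq_append[of 0 i "n - i"] upt_add_eq_append[of i j "n - j"]
        upt_add_eq_append[of j l "n - l"] by simp_all
    then have "w = map u [0..<i] @ (map u [i..<j] @ map u [j..<l]) @ map u [l..<n]"
      unfolding w_eq by simp
    then have "\<not> anagram (map u [i..<j] @ map u [j..<l])"
      using w(3) unfolding avoids_anagrams_def by blast
    moreover have "map u [i..<j] \<noteq> []" using *(1) by simp
    ultimately show "mset (map u [i..<j]) \<noteq> mset (map u [j..<l])"
      unfolding anagram_def by metis
  qed
qed

section \<open>The colouring of the subdivided tree\<close>

locale coloured_tree = subdivided_tree d h k K + tree_colouring K d g u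
  for d h k K g u +
  assumes d_pos: "d > 0"
begin

text \<open>The default 0 is a legitimate index as \<open>d > 0\<close>, so a chain has an index at
  every depth.\<close>

definition child :: "nat list \<Rightarrow> nat \<Rightarrow> nat" where
  "child xs D = (if D < length xs then rev xs ! D else 0)"

lemma child_less: "node xs \<Longrightarrow> child xs D < d"
  using d_pos nth_mem[of D "rev xs"] unfolding child_def node_def by auto

definition tint :: "nat list subdiv \<Rightarrow> nat" where
  "tint v = (let (xs, e) = SOME (xs, e). node xs \<and> e \<le> K * length xs \<and> spot xs e = v
     in hue (child xs) e)"

text \<open>The choice in \<open>tint\<close> is harmless: chains through a division vertex share
  its edge and child index, and the shade of an original vertex ignores the index.\<close>

lemma tint_spot:
  assumes "node xs" "e \<le> K * length xs"
  shows "tint (spot xs e) = hue (child xs) e"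
proof -
  obtain ys f where *: "(SOME (ys, f). node ys \<and> f \<le> K * length ys \<and> spot ys f = spot xs e) = (ys, f)"
    by (rule prod.exhaust)
  have "case (ys, f) of (ys, f) \<Rightarrow> node ys \<and> f \<le> K * length ys \<and> spot ys f = spot xs e"
    unfolding *[symmetric] by (rule someI[of _ "(xs, e)"]) (use assms in simp)
  then have ys: "node ys" "f \<le> K * length ys" "spot ys f = spot xs e" by auto
  then have "f = e" using spot_eqD(1) assms(2) by blast
  have "hue (child ys) e = hue (child xs) e"
  proof (cases "e mod K = 0")
    case True
    then show ?thesis unfolding shade_def by simp
  next
    case False
    note eqs = spot_eqD(3)[OF ys(2) assms(2) ys(3)]
    have "rev ys ! (e div K) = rev xs ! (e div K)"
      using eqs False unfolding \<open>f = e\<close> by (metis ancestor_Suc list.inject)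
    then show ?thesis using eqs False unfolding \<open>f = e\<close> child_def by simp
  qed
  then show ?thesis unfolding tint_def * using \<open>f = e\<close> by simp
qed

text \<open>The shorter side comes first, so the midpoint is on the longer one: \<open>P\<close> is
  the range \<open>{c<..Er}\<close>, and \<open>W\<close> is the shorter side followed by
  \<open>{E..c}\<close>.\<close>

lemma bent_path_no_anagram:
  assumes node: "node xs" "node ys" and le: "E \<le> El" "E \<le> Er" "El \<le> K * length xs" "Er \<le> K * length ys"
    and spotE: "spot xs E = spot ys E"
    and turn: "El = E \<or> Er = E \<or> spot xs (Suc E) \<noteq> spot ys (Suc E)"
    and short: "El - E \<le> Er - E"
  shows "\<not> anagram (map tint (bent_path xs ys E El Er))"
proof
  assume "anagram (map tint (bent_path xs ys E El Er))"
  then obtain W P where WP: "W \<noteq> []" "mset P = mset W" "map tint (bent_path xs ys E El Er) = W @ P"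
    unfolding anagram_def by blast
  have lenP: "length P = length W" using WP(2) by (metis size_mset)
  have "length (bent_path xs ys E El Er) = (El - E) + Suc (Er - E)"
    using le unfolding bent_path_def by (simp add: Suc_diff_le del: upt_Suc)
  then have len: "2 * length P = (El - E) + Suc (Er - E)"
    using arg_cong[OF WP(3), of length] lenP by simp
  define c where "c = Er - length P"
  have c: "E \<le> c" "c \<le> Er" "length P = Er - c" using len short le unfolding c_def by linarith+
  have split: "[E..<Suc Er] = [E..<Suc c] @ [Suc c..<Suc Er]"
    using c upt_add_eq_append[of E "Suc c" "Er - c"] by (simp del: upt_Suc)
  have "W @ P = (map tint (map (spot xs) (rev [Suc E..<Suc El])) @ map tint (map (spot ys) [E..<Suc c]))
      @ map tint (map (spot ys) [Suc c..<Suc Er])"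
    using WP(3) unfolding bent_path_def split by simp
  moreover have "length P = length (map tint (map (spot ys) [Suc c..<Suc Er]))"
    using c by (simp del: upt_Suc)
  ultimately have W: "W = map tint (map (spot xs) (rev [Suc E..<Suc El])) @ map tint (map (spot ys) [E..<Suc c])"
    and P: "P = map tint (map (spot ys) [Suc c..<Suc Er])"
    by (metis append_eq_append_conv)+
  have hue: "image_mset tint (image_mset (spot zs) (mset_set A)) = image_mset (hue (child zs)) (mset_set A)"
    if "node zs" "finite A" "\<And>e. e \<in> A \<Longrightarrow> e \<le> K * length zs" for zs A
    unfolding multiset.map_comp by (rule image_mset_cong) (use tint_spot[OF that(1)] that(2,3) in auto)
  have ivl: "{Suc a..<Suc b} = {a<..b}" "{a..<Suc b} = {a..b}" for a b by auto
  have mP: "mset P = image_mset (hue (child ys)) (mset_set {c<..Er})"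
    unfolding P mset_map mset_upt ivl(1) by (rule hue) (use node le in auto)
  have "mset W = image_mset tint (image_mset (spot xs) (mset_set {E<..El}))
      + image_mset tint (image_mset (spot ys) (mset_set {E..c}))"
    unfolding W by (simp only: mset_append mset_map mset_rev mset_upt ivl(1)) (simp only: ivl(2))
  also have "\<dots> = image_mset (hue (child xs)) (mset_set {E<..El}) + image_mset (hue (child ys)) (mset_set {E..c})"
    using node le c by (intro arg_cong2[of _ _ _ _ "(+)"] hue) auto
  finally have eq: "image_mset (hue (child ys)) (mset_set {c<..Er})
      = image_mset (hue (child xs)) (mset_set {E<..El}) + image_mset (hue (child ys)) (mset_set {E..c})"
    using mP WP(2) by simp
  \<comment> \<open>A division vertex has only one edge downwards, so a proper turn is at an
    original vertex, between different children.\<close>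
  have "El = E \<or> E mod K = 0 \<and> child ys (E div K) \<noteq> child xs (E div K)"
  proof (cases "El = E")
    case False
    then have ne: "spot xs (Suc E) \<noteq> spot ys (Suc E)" using turn short le by linarith
    have E: "E < K * length xs" "E < K * length ys" using False short le by linarith+
    then have D: "E div K < length xs" "E div K < length ys" by (simp_all add: div_less_if)
    have below: "Suc E \<le> K * Suc (E div K)" using dividend_less_times_div[of K E] by simp
    have "ancestor xs (Suc (E div K)) \<noteq> ancestor ys (Suc (E div K))"
      using ne spot_cong[of xs "Suc (E div K)" ys "Suc E"] D below by auto
    moreover from this have "E mod K = 0" using spot_eqD(3)[OF _ _ spotE] E by auto
    moreover from this have "ancestor xs (E div K) = ancestor ys (E div K)"
      using spot_eqD(2)[OF _ _ spotE] E by auto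
    ultimately show ?thesis using D by (auto simp: ancestor_Suc child_def)
  qed simp
  then show False
    by (rule no_anagram_on_chains[OF child_less[OF node(2)] child_less[OF node(1)] c(1,2) le(1) _ eq])
qed

theorem tint_anagram_free: "anagram_free_colouring S tint"
  unfolding anagram_free_colouring_def
proof (intro allI impI)
  fix p assume "is_path S p"
  then obtain xs ys E El Er where *: "node xs" "node ys" "E \<le> El" "E \<le> Er"
    "El \<le> K * length xs" "Er \<le> K * length ys" "spot xs E = spot ys E"
    "El = E \<or> Er = E \<or> spot xs (Suc E) \<noteq> spot ys (Suc E)" "p = bent_path xs ys E El Er"
    by (rule path_bent)
  show "\<not> anagram (map tint p)"
  proof (cases "El - E \<le> Er - E")
    case True
    then show ?thesis using bent_path_no_anagram[OF *(1-8)] *(9) by simp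
  next
    case False
    have "anagram (rev w)" if w: "anagram w" for w :: "nat list"
    proof -
      obtain W P where "W \<noteq> []" "mset P = mset W" "w = W @ P" using w unfolding anagram_def by blast
      then show ?thesis unfolding anagram_def by (intro exI[of _ "rev P"] exI[of _ "rev W"]) auto
    qed
    moreover have "rev (map tint p) = map tint (bent_path ys xs E Er El)"
      using rev_bent_path[OF *(3,4,7)] *(9) by (simp add: rev_map)
    moreover have "\<not> anagram (map tint (bent_path ys xs E Er El))"
      by (rule bent_path_no_anagram) (use * False in auto)
    ultimately show ?thesis by metis
  qed
qed

text \<open>Level \<open>h\<close> belongs to block \<open>h div g\<close>, whose largest colour is
  \<open>11 + 3 * (h div g)\<close>.\<close>

lemma tint_less: "tint ` verts S \<subseteq> {..<12 + 3 * (h div g)}"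
proof (rule image_subsetI)
  fix v assume "v \<in> verts S"
  then obtain xs e where xs: "node xs" "e \<le> K * length xs" "v = spot xs e" by (rule vertexE)
  then have "e div K \<le> length xs" using div_le_mono[of e "K * length xs" K] by simp
  then have "e div K div g \<le> h div g" using xs(1) unfolding node_def by (intro div_le_mono) simp
  then show "tint v \<in> {..<12 + 3 * (h div g)}"
    unfolding xs(3) tint_spot[OF xs(1,2)] shade_def Let_def
    using letters[of "e mod K div 2"] by auto
qed

end

section \<open>The block length and the final estimates\<close>

text \<open>With \<open>g\<close> about \<open>3 * L / 10\<close>, rounded up, three colours for
  each block after the first cost at most \<open>10 * h / L\<close>. The other twelve are the
  fillers, the neutral colour and the first block's three.\<close>

lemma upper_bound_arithmetic:
  fixes d h k :: nat
  assumes d: "d \<ge> 2" and k: "k > 2 * d"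
  defines "L \<equiv> log (real d + 1) (real k / (2 * real d))"
  defines "g \<equiv> nat \<lceil>3 * L / 10\<rceil>"
  shows "g \<ge> 1" "g \<ge> 2 \<Longrightarrow> 10 * d * (d + 1) ^ (g - 1) < k + 1"
    and "real (12 + 3 * (h div g)) \<le> 10 * real h / L + 14"
proof -
  have "real k / (2 * real d) > 1" using d k by (simp add: field_simps)
  then have L: "L > 0" unfolding L_def using d by simp
  have "3 * L / 10 \<le> real g" unfolding g_def using L by linarith
  then show "g \<ge> 1" using L by linarith
  have "real (h div g) \<le> real h / real g" by (rule of_nat_div_le_of_nat)
  also have "\<dots> \<le> real h / (3 * L / 10)"
    using \<open>3 * L / 10 \<le> real g\<close> L by (intro divide_left_mono) (auto intro: mult_pos_pos)
  finally have "3 * real (h div g) \<le> 10 * real h / L" using L by (simp add: field_simps)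
  then show "real (12 + 3 * (h div g)) \<le> 10 * real h / L + 14" by simp
  assume "g \<ge> 2"
  have "real g < 3 * L / 10 + 1" unfolding g_def using L by linarith
  \<comment> \<open>\<open>L\<close> exceeds \<open>10 * (g - 1) / 3\<close>, which is at least
    \<open>g + 1\<close> for \<open>g \<ge> 2\<close>.\<close>
  then have "real (g + 1) \<le> L" using \<open>g \<ge> 2\<close> by linarith
  have "(real d + 1) powr real (g + 1) = (real d + 1) ^ (g + 1)" by (rule powr_realpow) simp
  then have "real ((d + 1) ^ (g + 1)) = (real d + 1) powr real (g + 1)"
    by (simp only: of_nat_power of_nat_add of_nat_1)
  also have "\<dots> \<le> (real d + 1) powr L" using \<open>real (g + 1) \<le> L\<close> by (intro powr_mono) auto
  also have "\<dots> = real k / (2 * real d)"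
    unfolding L_def using d k by (subst powr_log_cancel) auto
  finally have "real (2 * d * (d + 1) ^ (g + 1)) \<le> real k" using d by (simp add: field_simps)
  then have le: "2 * d * (d + 1) ^ (g + 1) \<le> k" by (simp only: of_nat_le_iff)
  have "g + 1 = (g - 1) + 2" using \<open>g \<ge> 2\<close> by simp
  then have "2 * d * (d + 1) ^ (g + 1) = 2 * d * ((d + 1)\<^sup>2 * (d + 1) ^ (g - 1))"
    by (simp only: power_add mult.commute)
  \<comment> \<open>The two spare factors \<open>d + 1\<close> pay for the step from
    \<open>2 * d\<close> to \<open>10 * d\<close>.\<close>
  moreover have "5 \<le> (d + 1)\<^sup>2" using power_mono[of 3 "d + 1" 2] d by simp
  then have "2 * d * (5 * (d + 1) ^ (g - 1)) \<le> 2 * d * ((d + 1)\<^sup>2 * (d + 1) ^ (g - 1))"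
    by (intro mult_le_mono) auto
  moreover have "10 * d * (d + 1) ^ (g - 1) = 2 * d * (5 * (d + 1) ^ (g - 1))" by simp
  ultimately show "10 * d * (d + 1) ^ (g - 1) < k + 1" using le by linarith
qed

theorem theorem4:
  fixes d h k :: nat
  assumes "d \<ge> 2" and "h \<ge> 1" and "k > 2 * d"
  defines "S \<equiv> subdivision k (complete_tree d h)"
  shows "sqrt (real h / log (real (min d ((h * (k + 1))\<^sup>2))) (real (h * (k + 1))))
           \<le> real (anagram_free_number S)
       \<and> real (anagram_free_number S)
           \<le> 10 * real h / log (real d + 1) (real k / (2 * real d)) + 14"
proof -
  define g where "g = nat \<lceil>3 * log (real d + 1) (real k / (2 * real d)) / 10\<rceil>"
  note size = upper_bound_arithmetic[OF assms(1,3), folded g_def]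
  obtain u :: "nat \<Rightarrow> nat" where u: "\<And>i. u i < 8"
    "\<And>i j l. i < j \<Longrightarrow> j \<le> l \<Longrightarrow> l \<le> k + 1 \<Longrightarrow> mset (map u [i..<j]) \<noteq> mset (map u [j..<l])"
    using filler_letters[of "k + 1"] by blast
  interpret coloured_tree d h k "k + 1" g u
    by unfold_locales (use assms size u in auto)
  define N where "N = anagram_free_number S"
  have ex: "\<exists>c :: nat list subdiv \<Rightarrow> nat. c ` verts S \<subseteq> {..<12 + 3 * (h div g)} \<and> anagram_free_colouring S c"
    using tint_less tint_anagram_free unfolding S_def by blast
  have "N \<le> 12 + 3 * (h div g)"
    unfolding N_def anagram_free_number_def by (rule Least_le) (rule ex)
  then have upper: "real N \<le> 10 * real h / log (real d + 1) (real k / (2 * real d)) + 14"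
    using size(3)[of h] by linarith
  obtain c :: "nat list subdiv \<Rightarrow> nat" where c: "c ` verts S \<subseteq> {..<N}" "anagram_free_colouring S c"
    using LeastI_ex[of "\<lambda>n. \<exists>c :: nat list subdiv \<Rightarrow> nat. c ` verts S \<subseteq> {..<n} \<and> anagram_free_colouring S c"] ex
    unfolding N_def anagram_free_number_def by blast
  define n where "n = h * (k + 1)"
  have "d ^ h \<le> n ^ (N * N)"
    using colours_lower_bound[of c N] assms(1-3) c unfolding S_def n_def by simp
  then have "real d ^ h \<le> real n ^ (N * N)" by (metis of_nat_le_iff of_nat_power)
  have "1 * (k + 1) \<le> n" unfolding n_def using assms(2) by (intro mult_le_mono1) simp
  then have n: "d < n" using assms(3) by simp
  have "log (real d) (real d ^ h) \<le> log (real d) (real n ^ (N * N))"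
    using \<open>real d ^ h \<le> real n ^ (N * N)\<close> assms(1) by (intro log_mono) auto
  then have "real h \<le> real (N * N) * log (real d) (real n)"
    using assms(1) n by (simp add: log_nat_power)
  moreover have "log (real d) (real n) > 0" using assms(1) n by simp
  ultimately have "real h / log (real d) (real n) \<le> (real N)\<^sup>2"
    by (simp add: divide_le_eq power2_eq_square)
  then have "sqrt (real h / log (real d) (real n)) \<le> real N" by (intro real_le_lsqrt) simp
  \<comment> \<open>As \<open>d < n\<close>, the minimum in the base of the logarithm is
    \<open>d\<close>.\<close>
  moreover have "n \<le> n\<^sup>2" by (simp add: power2_eq_square)
  then have "min d (n\<^sup>2) = d" using n by simp
  ultimately show ?thesis using upper unfolding N_def n_def by simp
qed

end
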